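(* Let $\alpha\in\mathbb R$, $T>0$, and let $Z_t=\int_0^tK_Z(t,s)\,dW_s$ be a Gaussian Volterra process for which there exist $C>0$ and $\delta>0$ such that $$\mathbb E|Z_t-Z_s|^2\le C|t-s|^\delta\qquad\text{for all }0\le s\le t\le T .$$ Then (taking the continuous modification of $Z$) the equation $$U_t'-\alpha U_t=Z_t,\qquad U_0=0,$$ has the unique continuous solution $$U_t=e^{\alpha t}\int_0^te^{-\alpha s}Z_s\,ds,$$ and the Langevin equation $$Y_t=\alpha\int_0^tY_s\,ds+Z_t$$ has the unique continuous solution $$Y_t=U_t'=\alpha e^{\alpha t}\int_0^te^{-\alpha s}Z_s\,ds+Z_t ,$$ which can be represented as a Gaussian Volterra process $$Y_t=\int_0^tK_Y(t,u)\,dW_u,\qquad K_Y(t,u)=\alpha\int_u^te^{\alpha(t-s)}K_Z(s,u)\,ds+K_Z(t,u).$$ Here $t$ ranges over $[0,T]$.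
   Context: $W$ is a one-dimensional Wiener process and $K_Z$ is a deterministic (measurable) kernel with $\int_0^tK_Z^2(t,s)\,ds<\infty$ for every $t>0$. Solutions $Y$ of the Langevin equation are sought among processes with Lebesgue-integrable sample paths, and $U_t=\int_0^tY_s\,ds$ (hence $U_0=0$). Under the stated increment bound $Z$ has a modification that is continuous on $[0,T]$ (Kolmogorov's theorem), and this modification is used. *)

theory Defs
  imports "HOL-Probability.Probability"
begin

section \<open>Wiener process\<close>

definition wiener_process :: "'a measure \<Rightarrow> (real \<Rightarrow> 'a \<Rightarrow> real) \<Rightarrow> bool" where
  "wiener_process M W \<longleftrightarrow>
     prob_space M \<and>
     (\<forall>t\<ge>0. W t \<in> borel_measurable M) \<and>
     (AE \<omega> in M. W 0 \<omega> = 0) \<and>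
     (\<forall>s t. 0 \<le> s \<and> s < t \<longrightarrow>
        distributed M lborel (\<lambda>\<omega>. W t \<omega> - W s \<omega>) (normal_density 0 (sqrt (t - s)))) \<and>
     (\<forall>(n::nat) (\<tau> :: nat \<Rightarrow> real). 0 \<le> \<tau> 0 \<and> (\<forall>i<n. \<tau> i < \<tau> (Suc i)) \<longrightarrow>
        prob_space.indep_vars M (\<lambda>_. borel) (\<lambda>i \<omega>. W (\<tau> (Suc i)) \<omega> - W (\<tau> i) \<omega>) {..<n}) \<and>
     (AE \<omega> in M. continuous_on {0..} (\<lambda>t. W t \<omega>))"


section \<open>Wiener integral of a deterministic function\<close>

definition partition_of :: "real \<Rightarrow> nat \<Rightarrow> (nat \<Rightarrow> real) \<Rightarrow> bool" where
  "partition_of t n p \<longleftrightarrow> p 0 = 0 \<and> p n = t \<and> (\<forall>i<n. p i \<le> p (Suc i))"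

definition step_function :: "nat \<Rightarrow> (nat \<Rightarrow> real) \<Rightarrow> (nat \<Rightarrow> real) \<Rightarrow> real \<Rightarrow> real" where
  "step_function n p c s = (\<Sum>i<n. c i * indicator {p i<..p (Suc i)} s)"

definition step_integral ::
  "(real \<Rightarrow> 'a \<Rightarrow> real) \<Rightarrow> nat \<Rightarrow> (nat \<Rightarrow> real) \<Rightarrow> (nat \<Rightarrow> real) \<Rightarrow> 'a \<Rightarrow> real" where
  "step_integral W n p c \<omega> = (\<Sum>i<n. c i * (W (p (Suc i)) \<omega> - W (p i) \<omega>))"

definition square_integrable_on :: "(real \<Rightarrow> real) \<Rightarrow> real set \<Rightarrow> bool" where
  "square_integrable_on f A \<longleftrightarrow>
     set_borel_measurable lborel A f \<and> set_integrable lborel A (\<lambda>s. (f s)\<^sup>2)"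

text \<open>
  \<open>has_wiener_integral M W t f X\<close> says that the random variable \<open>X\<close> is a version of the
  integral of \<open>f\<close> with respect to \<open>W\<close> over \<open>[0,t]\<close>, that is, the mean-square limit of the
  integrals of step functions converging to \<open>f\<close> in \<open>L\<^sup>2[0,t]\<close>. It is a relation because
  the integral is only determined up to almost sure equality. The explicit integrability
  conditions rule out Bochner integrals that are zero by default.
\<close>

definition has_wiener_integral ::
  "'a measure \<Rightarrow> (real \<Rightarrow> 'a \<Rightarrow> real) \<Rightarrow> real \<Rightarrow> (real \<Rightarrow> real) \<Rightarrow> ('a \<Rightarrow> real) \<Rightarrow> bool" where
  "has_wiener_integral M W t f X \<longleftrightarrow>
     square_integrable_on f {0..t} \<and>
     X \<in> borel_measurable M \<and> integrable M (\<lambda>\<omega>. (X \<omega>)\<^sup>2) \<and>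
     (\<exists>(n :: nat \<Rightarrow> nat) (p :: nat \<Rightarrow> nat \<Rightarrow> real) (c :: nat \<Rightarrow> nat \<Rightarrow> real).
        (\<forall>k. partition_of t (n k) (p k)) \<and>
        (\<lambda>k. LBINT s:{0..t}. (f s - step_function (n k) (p k) (c k) s)\<^sup>2) \<longlonglongrightarrow> 0 \<and>
        (\<lambda>k. LINT \<omega>|M. (X \<omega> - step_integral W (n k) (p k) (c k) \<omega>)\<^sup>2) \<longlonglongrightarrow> 0)"


section \<open>Gaussian Volterra processes\<close>

definition volterra_kernel :: "real \<Rightarrow> (real \<Rightarrow> real \<Rightarrow> real) \<Rightarrow> bool" where
  "volterra_kernel T K \<longleftrightarrow>
     set_borel_measurable borel {(t, s). 0 \<le> s \<and> s \<le> t \<and> t \<le> T} (\<lambda>(t, s). K t s) \<and>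
     (\<forall>t\<in>{0..T}. square_integrable_on (K t) {0..t})"

text \<open>Equality of a process with its Volterra representation is almost sure for each time.\<close>

definition gaussian_volterra_process ::
  "'a measure \<Rightarrow> (real \<Rightarrow> 'a \<Rightarrow> real) \<Rightarrow> real \<Rightarrow> (real \<Rightarrow> real \<Rightarrow> real) \<Rightarrow>
   (real \<Rightarrow> 'a \<Rightarrow> real) \<Rightarrow> bool" where
  "gaussian_volterra_process M W T K Z \<longleftrightarrow>
     volterra_kernel T K \<and> (\<forall>t\<in>{0..T}. has_wiener_integral M W t (K t) (Z t))"


section \<open>Processes on a compact time interval\<close>

definition process_on :: "'a measure \<Rightarrow> real \<Rightarrow> (real \<Rightarrow> 'a \<Rightarrow> real) \<Rightarrow> bool" where
  "process_on M T X \<longleftrightarrow> (\<forall>t\<in>{0..T}. X t \<in> borel_measurable M)"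

definition continuous_process_on :: "'a measure \<Rightarrow> real \<Rightarrow> (real \<Rightarrow> 'a \<Rightarrow> real) \<Rightarrow> bool" where
  "continuous_process_on M T X \<longleftrightarrow>
     process_on M T X \<and> (\<forall>\<omega>\<in>space M. continuous_on {0..T} (\<lambda>t. X t \<omega>))"

definition continuous_modification ::
  "'a measure \<Rightarrow> real \<Rightarrow> (real \<Rightarrow> 'a \<Rightarrow> real) \<Rightarrow> (real \<Rightarrow> 'a \<Rightarrow> real) \<Rightarrow> bool" where
  "continuous_modification M T Z X \<longleftrightarrow>
     continuous_process_on M T X \<and> (\<forall>t\<in>{0..T}. AE \<omega> in M. X t \<omega> = Z t \<omega>)"

definition indistinguishable_on ::
  "'a measure \<Rightarrow> real \<Rightarrow> (real \<Rightarrow> 'a \<Rightarrow> real) \<Rightarrow> (real \<Rightarrow> 'a \<Rightarrow> real) \<Rightarrow> bool" where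
  "indistinguishable_on M T X Y \<longleftrightarrow> (AE \<omega> in M. \<forall>t\<in>{0..T}. X t \<omega> = Y t \<omega>)"


section \<open>The two equations\<close>

text \<open>At the end points of the time interval the derivative is one-sided.\<close>

definition solves_linear_ode ::
  "'a measure \<Rightarrow> real \<Rightarrow> real \<Rightarrow> (real \<Rightarrow> 'a \<Rightarrow> real) \<Rightarrow> (real \<Rightarrow> 'a \<Rightarrow> real) \<Rightarrow> bool" where
  "solves_linear_ode M T \<alpha> Z U \<longleftrightarrow>
     process_on M T U \<and>
     (AE \<omega> in M. U 0 \<omega> = 0 \<and>
        (\<forall>t\<in>{0..T}. \<exists>D. ((\<lambda>r. U r \<omega>) has_real_derivative D) (at t within {0..T}) \<and>
                        D - \<alpha> * U t \<omega> = Z t \<omega>))"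

definition solves_langevin ::
  "'a measure \<Rightarrow> real \<Rightarrow> real \<Rightarrow> (real \<Rightarrow> 'a \<Rightarrow> real) \<Rightarrow> (real \<Rightarrow> 'a \<Rightarrow> real) \<Rightarrow> bool" where
  "solves_langevin M T \<alpha> Z Y \<longleftrightarrow>
     process_on M T Y \<and>
     (AE \<omega> in M. set_integrable lebesgue {0..T} (\<lambda>s. Y s \<omega>) \<and>
        (\<forall>t\<in>{0..T}. Y t \<omega> = \<alpha> * (LINT s:{0..t}|lebesgue. Y s \<omega>) + Z t \<omega>))"

text \<open>
  The integral in the kernel exists for almost every \<open>u\<close>; at the exceptional points the
  Bochner integral is zero by convention.
\<close>

definition langevin_kernel :: "real \<Rightarrow> (real \<Rightarrow> real \<Rightarrow> real) \<Rightarrow> real \<Rightarrow> real \<Rightarrow> real" where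
  "langevin_kernel \<alpha> K t u = \<alpha> * (LBINT s:{u..t}. exp (\<alpha> * (t - s)) * K s u) + K t u"

end

theory Submission
  imports Defs
begin

text \<open>
  Gaussian increments turn the mean-square bound into bounds for all even moments, so Kolmogorov's
  theorem applies for every \<open>\<delta> > 0\<close>. Its proof here passes to the uniform limit of \<open>Z\<close> sampled at the
  left dyadic grid points: the sum over all levels of the weighted moments of the grid increments has
  finite expectation, hence the increments at level \<open>n\<close> decay geometrically almost surely. The two
  equations are then solved pathwise by variation of constants.

  For the Volterra representation only the stochastic Fubini identity
  \<open>\<integral> a(s) Z\<^sub>s ds = \<integral> (\<integral> a(s) K(s,u) ds) dW\<^sub>u\<close> is needed. Riemann sums of the left-hand side are Wiener integrals
  of the Riemann sums of the kernel. By Cauchy-Schwarz and Tonelli both families of Riemann sums converge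
  in mean square, with the same error bound, since by the Ito isometry the kernels \<open>K(s,\<cdot>)\<close> vary with \<open>s\<close> exactly
  as \<open>Z\<^sub>s\<close> does; and Wiener integrals are closed under mean-square limits.
\<close>


section \<open>Elementary integrands\<close>

text \<open>The relation \<open>has_wiener_integral\<close> is awkward to add: two integrals come
  with unrelated partitions, and integrals up to different times live on different intervals. The
  proof therefore works with \<open>wiener_limit\<close>, built on \<open>elementary\<close>, which
  generates integrand and integral together as a pair, so that no well-definedness has to be shown;
  sums, multiples and limits then follow from the triangle inequality. A single partition is
  recovered in \<open>elementary_partition\<close>, because the independence of increments, and with
  it the moment formula, speaks about one strictly increasing sequence of times. Distances are
  measured by \<open>nn_integral\<close>, where a missing integrability cannot make a distance
  vanish. The exponent 3 in the moment bound for Kolmogorov's theorem: at level n one factor 2^n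
  counts the grid increments, a second is the weight that turns finiteness of the sum into geometric
  decay, and the third leaves the summable 2^-n. The 2m-th moment of a centred normal variable of
  variance at most C h^\<delta> is of order h^(\<delta> m), so m is chosen with \<delta> m \<ge>
  3.\<close>

inductive elementary ::
  "(real \<Rightarrow> 'a \<Rightarrow> real) \<Rightarrow> real \<Rightarrow> (real \<Rightarrow> real) \<Rightarrow> ('a \<Rightarrow> real) \<Rightarrow> bool"
  for W t where
  zero: "elementary W t (\<lambda>_. 0) (\<lambda>_. 0)"
| step: "elementary W t \<phi> J \<Longrightarrow> 0 \<le> a \<Longrightarrow> a \<le> b \<Longrightarrow> b \<le> t \<Longrightarrow>
    elementary W t (\<lambda>s. \<phi> s + c * indicator {a<..b} s) (\<lambda>\<omega>. J \<omega> + c * (W b \<omega> - W a \<omega>))"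

lemma elementary_mono: "elementary W s \<phi> J \<Longrightarrow> s \<le> t \<Longrightarrow> elementary W t \<phi> J"
  by (induction rule: elementary.induct) (auto intro: elementary.intros)

lemma elementary_scale:
  "elementary W t \<phi> J \<Longrightarrow> elementary W t (\<lambda>s. r * \<phi> s) (\<lambda>\<omega>. r * J \<omega>)"
proof (induction rule: elementary.induct)
  case (step \<phi> J a b c)
  from elementary.step[OF step.IH step.hyps(2-4), of "r * c"] show ?case
    by (simp add: algebra_simps)
qed (simp add: elementary.zero)

lemma elementary_add:
  assumes "elementary W t \<phi> J"
  shows "elementary W t \<psi> L \<Longrightarrow> elementary W t (\<lambda>s. \<phi> s + \<psi> s) (\<lambda>\<omega>. J \<omega> + L \<omega>)"
proof (induction rule: elementary.induct)
  case (step \<psi> L a b c)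
  from elementary.step[OF step.IH step.hyps(2-4), of c] show ?case
    by (simp add: add.assoc)
qed (simp add: assms)

lemma elementary_borel[measurable_dest]: "elementary W t \<phi> J \<Longrightarrow> \<phi> \<in> borel_measurable borel"
  by (induction rule: elementary.induct) auto

lemma elementary_zero_outside: "elementary W t \<phi> J \<Longrightarrow> s \<notin> {0..t} \<Longrightarrow> \<phi> s = 0"
  by (induction rule: elementary.induct) (auto simp: indicator_def)

lemma partition_of_bounds:
  assumes "partition_of t n p" "i \<le> j" "j \<le> n"
  shows "0 \<le> p i" "p i \<le> p j" "p j \<le> t"
proof -
  have mono: "p i \<le> p j" if "i \<le> j" "j \<le> n" for i j
    using that assms(1) by (induction j rule: dec_induct) (auto simp: partition_of_def intro: order_trans)
  show "0 \<le> p i" using mono[of 0 i] assms by (simp add: partition_of_def)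
  show "p i \<le> p j" using mono assms by simp
  show "p j \<le> t" using mono[of j n] assms by (simp add: partition_of_def)
qed

lemma elementary_step_function:
  assumes "partition_of t n p"
  shows "elementary W t (step_function n p c) (step_integral W n p c)"
proof -
  have "m \<le> n \<Longrightarrow> elementary W t (\<lambda>s. step_function m p c s) (\<lambda>\<omega>. step_integral W m p c \<omega>)" for m
  proof (induction m)
    case 0
    then show ?case by (simp add: step_function_def step_integral_def elementary.zero)
  next
    case (Suc m)
    then show ?case
      using elementary.step[of W t _ _ "p m" "p (Suc m)" "c m"]
        partition_of_bounds[OF assms, of m "Suc m"]
      by (simp add: step_function_def step_integral_def)
  qed
  from this[of n] show ?thesis by simp
qed

section \<open>Rewriting elementary pairs on a common partition\<close>

lemma indicator_half_open_diff:
  fixes a b s :: real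
  assumes "a \<le> b"
  shows "indicator {a<..b} s = (of_bool (s \<le> b) - of_bool (s \<le> a) :: real)"
  using assms by (auto simp: indicator_def)

text \<open>Serves integrand and integral at once: with \<open>h j = of_bool (s \<le> p j)\<close>
  it collapses the indicators of the cells k, ..., l - 1 into one half-open indicator, with
  \<open>h j = W (p j) \<omega>\<close> the increments of \<open>W\<close> over the same
  cells.\<close>

lemma sum_block_telescope:
  fixes h :: "nat \<Rightarrow> real"
  assumes "k \<le> l" "l \<le> n"
  shows "(\<Sum>j<n. (if k \<le> j \<and> j < l then c else 0) * (h (Suc j) - h j)) = c * (h l - h k)"
proof -
  have "(\<Sum>j<n. (if k \<le> j \<and> j < l then c else 0) * (h (Suc j) - h j))
      = (\<Sum>j\<in>{k..<l}. c * (h (Suc j) - h j))"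
    using assms by (intro sum.mono_neutral_cong_right) auto
  also have "\<dots> = c * (h l - h k)"
    using sum_Suc_diff'[OF assms(1), of h] by (simp add: sum_distrib_left[symmetric])
  finally show ?thesis .
qed

lemma step_functionI:
  assumes "\<And>i. i < n \<Longrightarrow> p i \<le> p (Suc i)"
  shows "step_function n p c s = (\<Sum>i<n. c i * (of_bool (s \<le> p (Suc i)) - of_bool (s \<le> p i)))"
  using assms unfolding step_function_def
  by (intro sum.cong) (auto simp: indicator_half_open_diff)

text \<open>Quantifying over all partitions that contain a finite set \<open>A\<close>, instead of
  constructing one, is what lets the induction pass: a further summand enlarges \<open>A\<close> by
  its two end points and leaves the representation of the earlier ones available.\<close>

lemma elementary_refinement:
  assumes "elementary W t \<phi> J"
  shows "\<exists>A. finite A \<and> A \<subseteq> {0..t} \<and>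
    (\<forall>n p. (\<forall>i<n. p i < p (Suc i)) \<and> A \<subseteq> p ` {..n} \<longrightarrow>
      (\<exists>d. \<phi> = step_function n p d \<and> J = step_integral W n p d))"
  using assms
proof (induction rule: elementary.induct)
  case zero
  show ?case
    by (intro exI[of _ "{}"]) (auto simp: step_function_def step_integral_def intro!: exI[of _ "\<lambda>_. 0"])
next
  case (step \<phi> J a b c)
  from step.IH obtain A where A: "finite A" "A \<subseteq> {0..t}"
    and rep': "\<forall>n p. (\<forall>i<n. p i < p (Suc i)) \<and> A \<subseteq> p ` {..n} \<longrightarrow>
      (\<exists>d. \<phi> = step_function n p d \<and> J = step_integral W n p d)"
    by (elim exE conjE)
  note rep = rep'[rule_format, OF conjI]
  have "\<exists>d. (\<lambda>s. \<phi> s + c * indicator {a<..b} s) = step_function n p d \<and>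
      (\<lambda>\<omega>. J \<omega> + c * (W b \<omega> - W a \<omega>)) = step_integral W n p d"
    if p: "\<forall>i<n. p i < p (Suc i)" and sub: "insert a (insert b A) \<subseteq> p ` {..n}" for n p
  proof -
    obtain d where d: "\<phi> = step_function n p d" "J = step_integral W n p d"
      using rep[of n p] p sub by auto
    have p': "p i \<le> p (Suc i)" if "i < n" for i
      using p that less_imp_le by blast
    have strict: "p i < p j" if "i < j" "j \<le> n" for i j
      using that
    proof (induction j)
      case (Suc j)
      then have "p j < p (Suc j)" using p by simp
      with Suc show ?case by (cases "i = j") (auto intro: less_trans)
    qed simp
    obtain k l where kl: "k \<le> n" "l \<le> n" "a = p k" "b = p l"
      using sub by auto
    have "k \<le> l"
      using strict[of l k] kl step.hyps by (meson leD leI)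
    \<comment> \<open>The interval from \<open>a = p k\<close> to \<open>b = p l\<close> is the
      union of the cells \<open>k\<close>, ..., \<open>l - 1\<close>, and there \<open>c\<close> is
      added; for \<open>a = b\<close> there is no such cell.\<close>
    define e where "e j = d j + (if k \<le> j \<and> j < l then c else 0)" for j
    have "\<phi> s + c * indicator {a<..b} s = step_function n p e s" for s
      using sum_block_telescope[OF \<open>k \<le> l\<close> kl(2), of c "\<lambda>j. of_bool (s \<le> p j)"] step.hyps kl
      by (simp add: d step_functionI p' e_def distrib_right sum.distrib indicator_half_open_diff)
    moreover have "J \<omega> + c * (W b \<omega> - W a \<omega>) = step_integral W n p e \<omega>" for \<omega>
      using sum_block_telescope[OF \<open>k \<le> l\<close> kl(2), of c "\<lambda>j. W (p j) \<omega>"] kl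
      by (simp add: d step_integral_def e_def distrib_right sum.distrib)
    ultimately show ?thesis by blast
  qed
  then show ?case
    using A step.hyps
    by (intro exI[of _ "insert a (insert b A)"] conjI allI impI) (auto simp del: insert_subset)
qed

text \<open>The break points together with 0 and \<open>t\<close> are sorted without repetition,
  which makes the cells nondegenerate, as \<open>wiener_process\<close> requires for
  independence.\<close>

lemma elementary_partition:
  assumes "elementary W t \<phi> J" "0 \<le> t"
  obtains n p d where "partition_of t n p" "\<And>i. i < n \<Longrightarrow> p i < p (Suc i)"
    "\<phi> = step_function n p d" "J = step_integral W n p d"
proof -
  from elementary_refinement[OF assms(1)] obtain A where A: "finite A" "A \<subseteq> {0..t}"
    and rep': "\<forall>n p. (\<forall>i<n. p i < p (Suc i)) \<and> A \<subseteq> p ` {..n} \<longrightarrow>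
      (\<exists>d. \<phi> = step_function n p d \<and> J = step_integral W n p d)"
    by (elim exE conjE)
  note rep = rep'[rule_format, OF conjI]
  define B where "B = insert 0 (insert t A)"
  define L where "L = sorted_list_of_set B"
  have B: "finite B" "B \<subseteq> {0..t}" using A assms(2) by (auto simp: B_def)
  have L: "set L = B" "sorted L" "sorted_wrt (<) L" "L \<noteq> []"
    using B(1) strict_sorted_list_of_set[of B]
    by (simp_all only: L_def set_sorted_list_of_set sorted_sorted_list_of_set
        sorted_list_of_set_eq_Nil_iff) (simp_all add: B_def)
  \<comment> \<open>There is one cell fewer than there are points; \<open>t = 0\<close> gives
    \<open>n = 0\<close>.\<close>
  define n where "n = length L - 1"
  have len: "length L = Suc n" using L(4) by (simp add: n_def)
  have img: "(\<lambda>i. L ! i) ` {..n} = B"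
    unfolding L(1)[symmetric] set_conv_nth len by (auto simp: less_Suc_eq_le)
  have strict: "L ! i < L ! Suc i" if "i < n" for i
    using L(3) that len by (simp add: sorted_wrt_nth_less)
  have mono: "L ! i \<le> L ! j" if "i \<le> j" "j \<le> n" for i j
    using L(2) that len by (simp add: sorted_nth_mono)
  have "0 \<in> (\<lambda>i. L ! i) ` {..n}" "t \<in> (\<lambda>i. L ! i) ` {..n}"
    unfolding img by (auto simp: B_def)
  then obtain i j where ij: "i \<le> n" "j \<le> n" "L ! i = 0" "L ! j = t" by (metis atMost_iff imageE)
  have mem: "L ! i \<in> {0..t}" if "i \<le> n" for i
    using img B that by blast
  have "L ! 0 = 0" "L ! n = t"
    using mono[of 0 i] mono[of j n] mem[of 0] mem[of n] ij by auto
  then have "partition_of t n (\<lambda>i. L ! i)"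
    using strict by (auto simp: partition_of_def less_imp_le)
  moreover obtain d where "\<phi> = step_function n (\<lambda>i. L ! i) d" "J = step_integral W n (\<lambda>i. L ! i) d"
    using rep[of n "\<lambda>i. L ! i"] strict img by (auto simp: B_def)
  ultimately show ?thesis using that strict by blast
qed

section \<open>Squares and integrals of step functions\<close>

lemma step_function_zero_right:
  assumes "\<And>i. i < n \<Longrightarrow> p i \<le> p (Suc i)" "p n < s"
  shows "step_function n p c s = 0"
proof -
  have "p i \<le> p n" if "i \<le> n" for i
    using that assms(1) by (induction i rule: inc_induct) (auto intro: order_trans)
  then have "p (Suc i) < s" if "i < n" for i
    using assms(2) that by (meson Suc_leI le_less_trans)
  then show ?thesis
    unfolding step_function_def
    by (intro sum.neutral) (force simp: indicator_def)
qed

text \<open>Distinct cells are disjoint, so the mixed products vanish: on the last cell all earlier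
  summands are zero, off it the last one is.\<close>

lemma step_function_square:
  assumes "\<And>i. i < n \<Longrightarrow> p i \<le> p (Suc i)"
  shows "(step_function n p c s)\<^sup>2 = step_function n p (\<lambda>i. (c i)\<^sup>2) s"
  using assms
proof (induction n)
  case (Suc n)
  show ?case
  proof (cases "s \<in> {p n<..p (Suc n)}")
    case True
    then have "step_function n p d s = 0" for d
      using Suc.prems by (intro step_function_zero_right) auto
    with True show ?thesis by (simp add: step_function_def)
  next
    case False
    with Suc show ?thesis by (simp add: step_function_def)
  qed
qed (simp add: step_function_def)

lemma has_bochner_integral_step_function:
  assumes "\<And>i. i < n \<Longrightarrow> p i \<le> p (Suc i)"
  shows "has_bochner_integral lborel (step_function n p c) (\<Sum>i<n. c i * (p (Suc i) - p i))"
proof -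
  have "has_bochner_integral lborel (indicator {p i<..p (Suc i)} :: real \<Rightarrow> real) (p (Suc i) - p i)"
    if "i < n" for i
    using assms[OF that] has_bochner_integral_real_indicator[of "{p i<..p (Suc i)}" lborel] by simp
  then show ?thesis
    unfolding step_function_def[abs_def]
    by (intro has_bochner_integral_sum has_bochner_integral_mult_right) auto
qed

section \<open>Moments of elementary integrals\<close>

text \<open>The moment of order 2k of a standard normal variable, (2k-1)!! in closed form.\<close>

definition gaussian_moment :: "nat \<Rightarrow> real" where
  "gaussian_moment k = fact (2 * k) / (2 ^ k * fact k)"

lemma gaussian_moment_pos: "0 < gaussian_moment k"
  by (simp add: gaussian_moment_def)

lemma gaussian_moment_1: "gaussian_moment 1 = 1"
  by (simp add: gaussian_moment_def)

lemma normal_even_moment: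
  assumes "prob_space M" "distributed M lborel X (normal_density 0 \<sigma>)" "0 < \<sigma>"
  shows "has_bochner_integral M (\<lambda>\<omega>. X \<omega> ^ (2 * k)) (gaussian_moment k * (\<sigma>\<^sup>2) ^ k)"
proof -
  interpret prob_space M by fact
  note N = normal_moment_even[OF assms(3), of 0 k]
  have "integrable lborel (\<lambda>x. normal_density 0 \<sigma> x * x ^ (2 * k)) \<longleftrightarrow>
      integrable M (\<lambda>\<omega>. X \<omega> ^ (2 * k))"
    by (rule distributed_integrable[OF assms(2)]) auto
  then have "integrable M (\<lambda>\<omega>. X \<omega> ^ (2 * k))"
    using integrable.intros[OF N] unfolding diff_0_right by blast
  moreover have "(LINT \<omega>|M. X \<omega> ^ (2 * k)) = gaussian_moment k * (\<sigma>\<^sup>2) ^ k"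
    using distributed_integral[OF assms(2), of "\<lambda>x. x ^ (2 * k)"] N assms(3)
    by (simp add: has_bochner_integral_iff gaussian_moment_def power_divide)
  ultimately show ?thesis by (simp add: has_bochner_integral_iff)
qed

lemma step_integral_moment:
  assumes W: "wiener_process M W" and p0: "0 \<le> p 0" and p: "\<And>i. i < n \<Longrightarrow> p i < p (Suc i)"
  shows "has_bochner_integral M (\<lambda>\<omega>. step_integral W n p d \<omega> ^ (2 * k))
    (gaussian_moment k * (\<Sum>i<n. (d i)\<^sup>2 * (p (Suc i) - p i)) ^ k)"
proof -
  interpret prob_space M using W by (simp add: wiener_process_def)
  \<comment> \<open>\<open>sum_indep_normal\<close> is applied with positive standard deviations, so
    cells with coefficient zero are dropped.\<close>
  define I where "I = {i. i < n \<and> d i \<noteq> 0}"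
  have I: "finite I" "I \<subseteq> {..<n}" by (auto simp: I_def)
  define X where "X i \<omega> = d i * (W (p (Suc i)) \<omega> - W (p i) \<omega>)" for i \<omega>
  have pos: "0 \<le> p i" if "i \<le> n" for i
    using that
  proof (induction i)
    case (Suc i)
    then show ?case using p[of i] by simp
  qed (use p0 in simp)
  have eq: "step_integral W n p d \<omega> = (\<Sum>i\<in>I. X i \<omega>)" for \<omega>
    unfolding step_integral_def X_def by (rule sum.mono_neutral_right) (auto simp: I_def)
  have var: "(\<Sum>i<n. (d i)\<^sup>2 * (p (Suc i) - p i)) = (\<Sum>i\<in>I. (d i)\<^sup>2 * (p (Suc i) - p i))"
    by (rule sum.mono_neutral_right) (auto simp: I_def)
  show ?thesis
  proof (cases "I = {}")
    case True
    \<comment> \<open>With no cell left both sides are 0, except for \<open>k = 0\<close>, where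
      they are 1; writing \<open>0 ^ (2 * k)\<close> covers both.\<close>
    have "has_bochner_integral M (\<lambda>_. 0 ^ (2 * k) :: real) (0 ^ (2 * k))"
      by (simp add: has_bochner_integral_iff prob_space)
    then show ?thesis
      unfolding eq var True by (cases k) (simp_all add: gaussian_moment_def)
  next
    case False
    have ind: "indep_vars (\<lambda>_. borel) X I"
    proof -
      have "indep_vars (\<lambda>_. borel) (\<lambda>i \<omega>. W (p (Suc i)) \<omega> - W (p i) \<omega>) {..<n}"
        using W p0 p by (auto simp: wiener_process_def)
      then have "indep_vars (\<lambda>_. borel) (\<lambda>i \<omega>. W (p (Suc i)) \<omega> - W (p i) \<omega>) I"
        using I(2) by (rule indep_vars_subset)
      then have "indep_vars (\<lambda>_. borel) (\<lambda>i \<omega>. (\<lambda>x. d i * x) (W (p (Suc i)) \<omega> - W (p i) \<omega>)) I"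
        by (rule indep_vars_compose2) simp
      then show ?thesis unfolding X_def[abs_def] .
    qed
    define \<sigma> where "\<sigma> i = \<bar>d i\<bar> * sqrt (p (Suc i) - p i)" for i
    have \<sigma>: "0 < \<sigma> i" "(\<sigma> i)\<^sup>2 = (d i)\<^sup>2 * (p (Suc i) - p i)" if "i \<in> I" for i
      using that p[of i] by (auto simp: \<sigma>_def I_def power_mult_distrib)
    have norm: "distributed M lborel (X i) (normal_density 0 (\<sigma> i))" if "i \<in> I" for i
    proof -
      have "distributed M lborel (\<lambda>\<omega>. W (p (Suc i)) \<omega> - W (p i) \<omega>) (normal_density 0 (sqrt (p (Suc i) - p i)))"
        using W pos[of i] p[of i] that by (auto simp: wiener_process_def I_def)
      from normal_density_affine[OF this, of "d i" 0] show ?thesis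
        using that p[of i] by (simp add: X_def[abs_def] \<sigma>_def I_def)
    qed
    have S: "(\<Sum>i\<in>I. (\<sigma> i)\<^sup>2) = (\<Sum>i\<in>I. (d i)\<^sup>2 * (p (Suc i) - p i))"
      by (intro sum.cong) (auto simp: \<sigma>)
    have S0: "0 < (\<Sum>i\<in>I. (\<sigma> i)\<^sup>2)"
      using \<sigma>(1) False I(1) by (intro sum_pos zero_less_power) blast+
    have "distributed M lborel (\<lambda>\<omega>. \<Sum>i\<in>I. X i \<omega>) (normal_density 0 (sqrt (\<Sum>i\<in>I. (\<sigma> i)\<^sup>2)))"
      using sum_indep_normal[OF I(1) False ind \<sigma>(1) norm] by simp
    from normal_even_moment[OF prob_space_axioms this, of k] S0
    show ?thesis unfolding eq var S by simp
  qed
qed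

lemma elementary_integrable:
  assumes "elementary W t \<phi> J" "0 \<le> t"
  shows "integrable lborel (\<lambda>s. (\<phi> s)\<^sup>2)"
proof -
  obtain n p d where "partition_of t n p" and p: "\<And>i. i < n \<Longrightarrow> p i < p (Suc i)"
    and "\<phi> = step_function n p d" "J = step_integral W n p d"
    using elementary_partition[OF assms] by blast
  then show ?thesis
    using has_bochner_integral_step_function[of n p "\<lambda>i. (d i)\<^sup>2"] p
    by (simp add: step_function_square less_imp_le has_bochner_integral_iff)
qed

lemma elementary_moment:
  assumes "wiener_process M W" "elementary W t \<phi> J" "0 \<le> t"
  shows "has_bochner_integral M (\<lambda>\<omega>. J \<omega> ^ (2 * k)) (gaussian_moment k * (LINT s|lborel. (\<phi> s)\<^sup>2) ^ k)"
proof -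
  obtain n p d where part: "partition_of t n p" and p: "\<And>i. i < n \<Longrightarrow> p i < p (Suc i)"
    and eq: "\<phi> = step_function n p d" "J = step_integral W n p d"
    using elementary_partition[OF assms(2,3)] by blast
  have "(LINT s|lborel. (\<phi> s)\<^sup>2) = (\<Sum>i<n. (d i)\<^sup>2 * (p (Suc i) - p i))"
    using has_bochner_integral_step_function[of n p "\<lambda>i. (d i)\<^sup>2"] p
    by (simp add: eq step_function_square less_imp_le has_bochner_integral_iff)
  then show ?thesis
    using step_integral_moment[OF assms(1), of p n d k] part p
    by (simp add: eq partition_of_def)
qed

lemma elementary_measurable:
  assumes "wiener_process M W" "elementary W t \<phi> J"
  shows "J \<in> borel_measurable M"
  using assms(2)
proof (induction rule: elementary.induct)
  case (step \<phi> J a b c)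
  then have [measurable]: "W a \<in> borel_measurable M" "W b \<in> borel_measurable M"
    "J \<in> borel_measurable M"
    using assms(1) by (auto simp: wiener_process_def)
  show ?case by measurable
qed simp


section \<open>Mean-square distances\<close>

lemma square_diff_le: "(x - z)\<^sup>2 \<le> 2 * (x - y)\<^sup>2 + 2 * (y - z)\<^sup>2" for x y z :: real
proof -
  have "2 * (x - y)\<^sup>2 + 2 * (y - z)\<^sup>2 - (x - z)\<^sup>2 = (x - 2 * y + z)\<^sup>2"
    by (simp add: power2_eq_square algebra_simps)
  then show ?thesis by (smt (verit) zero_le_power2)
qed

text \<open>Squared distances obey the triangle inequality up to a factor 2; in
  \<open>ennreal\<close> this takes measurability alone.\<close>

lemma nn_integral_square_diff_le:
  fixes f g h :: "'a \<Rightarrow> real"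
  assumes [measurable]: "f \<in> borel_measurable N" "g \<in> borel_measurable N" "h \<in> borel_measurable N"
  shows "(\<integral>\<^sup>+x. ennreal ((f x - h x)\<^sup>2) \<partial>N)
    \<le> 2 * (\<integral>\<^sup>+x. ennreal ((f x - g x)\<^sup>2) \<partial>N) + 2 * (\<integral>\<^sup>+x. ennreal ((g x - h x)\<^sup>2) \<partial>N)"
proof -
  have "(\<integral>\<^sup>+x. ennreal ((f x - h x)\<^sup>2) \<partial>N)
      \<le> (\<integral>\<^sup>+x. 2 * ennreal ((f x - g x)\<^sup>2) + 2 * ennreal ((g x - h x)\<^sup>2) \<partial>N)"
  proof (intro nn_integral_mono)
    fix x
    have "ennreal ((f x - h x)\<^sup>2) \<le> ennreal (2 * (f x - g x)\<^sup>2 + 2 * (g x - h x)\<^sup>2)"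
      by (intro ennreal_leI square_diff_le)
    then show "ennreal ((f x - h x)\<^sup>2) \<le> 2 * ennreal ((f x - g x)\<^sup>2) + 2 * ennreal ((g x - h x)\<^sup>2)"
      by (simp add: ennreal_plus ennreal_mult)
  qed
  then show ?thesis by (simp add: nn_integral_add nn_integral_cmult)
qed

lemma integrable_square_diff:
  fixes f g :: "'a \<Rightarrow> real"
  assumes [measurable]: "f \<in> borel_measurable N" "g \<in> borel_measurable N"
    and "integrable N (\<lambda>x. (f x)\<^sup>2)" "integrable N (\<lambda>x. (g x)\<^sup>2)"
  shows "integrable N (\<lambda>x. (f x - g x)\<^sup>2)"
proof (rule Bochner_Integration.integrable_bound)
  show "integrable N (\<lambda>x. 2 * (f x)\<^sup>2 + 2 * (g x)\<^sup>2)"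
    using assms by simp
  show "AE x in N. norm ((f x - g x)\<^sup>2) \<le> norm (2 * (f x)\<^sup>2 + 2 * (g x)\<^sup>2)"
    using square_diff_le[of _ _ 0] by (intro AE_I2) simp
qed simp

lemma integrable_square_of_close:
  fixes f g :: "'a \<Rightarrow> real"
  assumes [measurable]: "f \<in> borel_measurable N" "g \<in> borel_measurable N"
    and g: "integrable N (\<lambda>x. (g x)\<^sup>2)" and fin: "(\<integral>\<^sup>+x. ennreal ((f x - g x)\<^sup>2) \<partial>N) < \<infinity>"
  shows "integrable N (\<lambda>x. (f x)\<^sup>2)"
proof (rule integrableI_nonneg)
  have "(\<integral>\<^sup>+x. ennreal ((g x - 0)\<^sup>2) \<partial>N) < \<infinity>"
    using g by (simp add: nn_integral_eq_integral)
  then have "2 * (\<integral>\<^sup>+x. ennreal ((f x - g x)\<^sup>2) \<partial>N) + 2 * (\<integral>\<^sup>+x. ennreal ((g x - 0)\<^sup>2) \<partial>N) < \<infinity>"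
    using fin by (simp add: ennreal_mult_less_top)
  then show "(\<integral>\<^sup>+x. ennreal ((f x)\<^sup>2) \<partial>N) < \<infinity>"
    using nn_integral_square_diff_le[of f N g "\<lambda>_. 0"] by (auto intro: le_less_trans)
qed auto

text \<open>
  The estimate \<open>\<bar>g\<^sup>2 - f\<^sup>2\<bar> \<le> (1 + 1/\<eta>) (f - g)\<^sup>2 + \<eta> f\<^sup>2\<close> is used with \<open>\<eta>\<close> slightly larger
  than the mean-square distance, so that \<open>\<eta> > 0\<close> even if the distance vanishes.
\<close>

lemma tendsto_integral_square:
  fixes f :: "'a \<Rightarrow> real" and g :: "nat \<Rightarrow> 'a \<Rightarrow> real"
  assumes [measurable]: "f \<in> borel_measurable N" "\<And>k. g k \<in> borel_measurable N"
    and f: "integrable N (\<lambda>x. (f x)\<^sup>2)" and g: "\<And>k. integrable N (\<lambda>x. (g k x)\<^sup>2)"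
    and lim: "(\<lambda>k. LINT x|N. (f x - g k x)\<^sup>2) \<longlonglongrightarrow> 0"
  shows "(\<lambda>k. LINT x|N. (g k x)\<^sup>2) \<longlonglongrightarrow> (LINT x|N. (f x)\<^sup>2)"
proof -
  define A where "A = (LINT x|N. (f x)\<^sup>2)"
  define \<epsilon> where "\<epsilon> k = (LINT x|N. (f x - g k x)\<^sup>2)" for k
  define \<eta> where "\<eta> k = sqrt (\<epsilon> k) + 1 / real (Suc k)" for k
  have [simp]: "0 \<le> \<epsilon> k" for k by (simp add: \<epsilon>_def)
  have \<eta>: "0 < \<eta> k" for k by (simp add: \<eta>_def add_nonneg_pos)
  have \<epsilon>\<eta>: "\<epsilon> k / \<eta> k \<le> sqrt (\<epsilon> k)" for k
  proof -
    have "\<epsilon> k = sqrt (\<epsilon> k) * sqrt (\<epsilon> k)" by simp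
    also have "\<dots> \<le> sqrt (\<epsilon> k) * \<eta> k" by (intro mult_left_mono) (auto simp: \<eta>_def)
    finally show ?thesis using \<eta>[of k] by (simp add: divide_le_eq)
  qed
  have pt: "\<bar>y\<^sup>2 - x\<^sup>2\<bar> \<le> (x - y)\<^sup>2 + (x - y)\<^sup>2 / e + e * x\<^sup>2" if "0 < e" for x y e :: real
  proof -
    have s: "\<bar>2 * x * (y - x)\<bar> \<le> (x - y)\<^sup>2 / e + e * x\<^sup>2"
    proof -
      have "(x - y)\<^sup>2 / e + e * x\<^sup>2 - 2 * x * (y - x) = ((x - y) / sqrt e + sqrt e * x)\<^sup>2"
        "(x - y)\<^sup>2 / e + e * x\<^sup>2 + 2 * x * (y - x) = ((x - y) / sqrt e - sqrt e * x)\<^sup>2"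
        using that by (simp_all add: power2_sum power2_diff power_divide power_mult_distrib)
          (simp_all add: field_simps power2_eq_square)
      then show ?thesis by (smt (verit) zero_le_power2)
    qed
    have "y\<^sup>2 - x\<^sup>2 = (x - y)\<^sup>2 + 2 * x * (y - x)"
      by (simp add: power2_eq_square algebra_simps)
    with s show ?thesis by (smt (verit) zero_le_power2)
  qed
  have "\<bar>(LINT x|N. (g k x)\<^sup>2) - A\<bar> \<le> \<epsilon> k + sqrt (\<epsilon> k) + \<eta> k * A" for k
  proof -
    have D: "integrable N (\<lambda>x. (f x - g k x)\<^sup>2)"
      using f g by (intro integrable_square_diff) auto
    have "\<bar>(LINT x|N. (g k x)\<^sup>2) - A\<bar> = \<bar>LINT x|N. (g k x)\<^sup>2 - (f x)\<^sup>2\<bar>"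
      using f g by (simp add: A_def)
    also have "\<dots> \<le> (LINT x|N. \<bar>(g k x)\<^sup>2 - (f x)\<^sup>2\<bar>)"
      by (rule integral_abs_bound)
    also have "\<dots> \<le> (LINT x|N. (f x - g k x)\<^sup>2 + (f x - g k x)\<^sup>2 / \<eta> k + \<eta> k * (f x)\<^sup>2)"
      using f g D \<eta> by (intro integral_mono pt) auto
    also have "\<dots> = \<epsilon> k + \<epsilon> k / \<eta> k + \<eta> k * A"
      using f D by (simp add: A_def \<epsilon>_def)
    finally show ?thesis using \<epsilon>\<eta>[of k] by simp
  qed
  then have "\<forall>\<^sub>F k in sequentially. norm ((LINT x|N. (g k x)\<^sup>2) - A) \<le> \<epsilon> k + sqrt (\<epsilon> k) + \<eta> k * A"
    by simp
  moreover have "(\<lambda>k. \<epsilon> k + sqrt (\<epsilon> k) + \<eta> k * A) \<longlonglongrightarrow> 0"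
  proof -
    have "\<epsilon> \<longlonglongrightarrow> 0" using lim by (simp add: \<epsilon>_def[abs_def])
    moreover from tendsto_real_sqrt[OF this] have s: "(\<lambda>k. sqrt (\<epsilon> k)) \<longlonglongrightarrow> 0" by simp
    moreover from tendsto_add[OF s LIMSEQ_inverse_real_of_nat]
    have "\<eta> \<longlonglongrightarrow> 0" by (simp add: \<eta>_def[abs_def] inverse_eq_divide)
    ultimately show ?thesis
      using tendsto_add[OF tendsto_add tendsto_mult_left_zero, of \<epsilon> 0 sequentially] by fastforce
  qed
  ultimately have "(\<lambda>k. (LINT x|N. (g k x)\<^sup>2) - A) \<longlonglongrightarrow> 0"
    by (rule Lim_null_comparison)
  then show ?thesis by (simp add: A_def LIM_zero_iff)
qed

section \<open>The Wiener integral on the line\<close>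

text \<open>
  Extending integrands by zero to the whole line makes it possible to add integrals over
  intervals of different lengths.
\<close>

definition wiener_limit ::
  "'a measure \<Rightarrow> (real \<Rightarrow> 'a \<Rightarrow> real) \<Rightarrow> real \<Rightarrow> (real \<Rightarrow> real) \<Rightarrow> ('a \<Rightarrow> real) \<Rightarrow> bool" where
  "wiener_limit M W t f X \<longleftrightarrow> f \<in> borel_measurable borel \<and> X \<in> borel_measurable M \<and>
    (\<forall>e>0. \<exists>\<phi> J. elementary W t \<phi> J \<and>
      (\<integral>\<^sup>+s. ennreal ((f s - \<phi> s)\<^sup>2) \<partial>lborel) < ennreal e \<and>
      (\<integral>\<^sup>+\<omega>. ennreal ((X \<omega> - J \<omega>)\<^sup>2) \<partial>M) < ennreal e)"

lemma wiener_limit_measurable: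
  assumes "wiener_limit M W t f X"
  shows "f \<in> borel_measurable borel" "X \<in> borel_measurable M"
  using assms by (auto simp: wiener_limit_def)

lemma wiener_limit_mono:
  "wiener_limit M W s f X \<Longrightarrow> s \<le> t \<Longrightarrow> wiener_limit M W t f X"
  unfolding wiener_limit_def by (meson elementary_mono)

lemma ennreal_double_sum_less:
  assumes "a < ennreal (e / 4)" "b < ennreal (e / 4)" "0 < e"
  shows "2 * a + 2 * b < ennreal e"
proof -
  obtain a' where a: "a = ennreal a'" "0 \<le> a'" using assms(1) by (cases a) auto
  obtain b' where b: "b = ennreal b'" "0 \<le> b'" using assms(2) by (cases b) auto
  have "a' < e / 4" "b' < e / 4" using assms a b by (auto simp: ennreal_less_iff)
  then have "2 * a' + 2 * b' < e" by simp
  then have "ennreal (2 * a' + 2 * b') < ennreal e"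
    using assms(3) by (rule ennreal_lessI[rotated])
  also have "ennreal (2 * a' + 2 * b') = 2 * a + 2 * b"
    using a b by (simp add: ennreal_plus ennreal_mult)
  finally show ?thesis .
qed

text \<open>Approximation by pairs that are themselves limits is enough: a further approximation of
  \<open>g\<close> and \<open>Y\<close> costs only the factor 2 on each part, hence the
  \<open>e / 4\<close>. The later closure properties go through this rule.\<close>

lemma wiener_limit_closed:
  assumes W: "wiener_process M W"
    and [measurable]: "f \<in> borel_measurable borel" "X \<in> borel_measurable M"
    and approx: "\<And>e. 0 < e \<Longrightarrow> \<exists>g Y. wiener_limit M W t g Y \<and>
      (\<integral>\<^sup>+s. ennreal ((f s - g s)\<^sup>2) \<partial>lborel) < ennreal e \<and>
      (\<integral>\<^sup>+\<omega>. ennreal ((X \<omega> - Y \<omega>)\<^sup>2) \<partial>M) < ennreal e"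
  shows "wiener_limit M W t f X"
  unfolding wiener_limit_def
proof (intro conjI allI impI)
  fix e :: real assume e: "0 < e"
  then have e4: "0 < e / 4" by simp
  from approx[OF e4] obtain g Y where gY: "wiener_limit M W t g Y"
    "(\<integral>\<^sup>+s. ennreal ((f s - g s)\<^sup>2) \<partial>lborel) < ennreal (e / 4)"
    "(\<integral>\<^sup>+\<omega>. ennreal ((X \<omega> - Y \<omega>)\<^sup>2) \<partial>M) < ennreal (e / 4)" by blast
  from gY(1) e4 obtain \<phi> J where J: "elementary W t \<phi> J"
      "(\<integral>\<^sup>+s. ennreal ((g s - \<phi> s)\<^sup>2) \<partial>lborel) < ennreal (e / 4)"
      "(\<integral>\<^sup>+\<omega>. ennreal ((Y \<omega> - J \<omega>)\<^sup>2) \<partial>M) < ennreal (e / 4)"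
    unfolding wiener_limit_def by blast
  note [measurable] = wiener_limit_measurable[OF gY(1)] elementary_borel[OF J(1)]
    elementary_measurable[OF W J(1)]
  have "(\<integral>\<^sup>+s. ennreal ((f s - \<phi> s)\<^sup>2) \<partial>lborel) < ennreal e"
    by (rule le_less_trans[OF nn_integral_square_diff_le ennreal_double_sum_less[OF gY(2) J(2) e]]) simp_all
  moreover have "(\<integral>\<^sup>+\<omega>. ennreal ((X \<omega> - J \<omega>)\<^sup>2) \<partial>M) < ennreal e"
    by (rule le_less_trans[OF nn_integral_square_diff_le ennreal_double_sum_less[OF gY(3) J(3) e]]) simp_all
  ultimately show "\<exists>\<phi> J. elementary W t \<phi> J \<and>
      (\<integral>\<^sup>+s. ennreal ((f s - \<phi> s)\<^sup>2) \<partial>lborel) < ennreal e \<and>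
      (\<integral>\<^sup>+\<omega>. ennreal ((X \<omega> - J \<omega>)\<^sup>2) \<partial>M) < ennreal e"
    using J(1) by blast
qed simp_all

lemma wiener_limit_elementary:
  assumes "wiener_process M W" "elementary W t \<phi> J"
  shows "wiener_limit M W t \<phi> J"
  unfolding wiener_limit_def
  using elementary_borel[OF assms(2)] elementary_measurable[OF assms] assms(2)
  by (auto intro!: exI[of _ \<phi>] exI[of _ J])

text \<open>An almost everywhere equal pair is at distance zero, so the given limit approximates it
  for every \<open>e\<close>.\<close>

lemma wiener_limit_cong_AE:
  assumes W: "wiener_process M W" and "wiener_limit M W t f X"
    and [measurable]: "g \<in> borel_measurable borel" "Y \<in> borel_measurable M"
    and "AE s in lborel. f s = g s" "AE \<omega> in M. X \<omega> = Y \<omega>"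
  shows "wiener_limit M W t g Y"
proof (rule wiener_limit_closed[OF W])
  fix e :: real assume e: "0 < e"
  note [measurable] = wiener_limit_measurable[OF assms(2)]
  have "AE s in lborel. ennreal ((g s - f s)\<^sup>2) = 0" "AE \<omega> in M. ennreal ((Y \<omega> - X \<omega>)\<^sup>2) = 0"
    using assms(5,6) by auto
  then have "(\<integral>\<^sup>+s. ennreal ((g s - f s)\<^sup>2) \<partial>lborel) = 0" "(\<integral>\<^sup>+\<omega>. ennreal ((Y \<omega> - X \<omega>)\<^sup>2) \<partial>M) = 0"
    by (simp_all add: nn_integral_0_iff_AE)
  then show "\<exists>f X. wiener_limit M W t f X \<and>
      (\<integral>\<^sup>+s. ennreal ((g s - f s)\<^sup>2) \<partial>lborel) < ennreal e \<and>
      (\<integral>\<^sup>+\<omega>. ennreal ((Y \<omega> - X \<omega>)\<^sup>2) \<partial>M) < ennreal e"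
    using assms(2) e by (intro exI[of _ f] exI[of _ X]) simp
qed simp_all

lemma nn_integral_square_scale:
  fixes f :: "'a \<Rightarrow> real"
  assumes [measurable]: "f \<in> borel_measurable N" "g \<in> borel_measurable N"
  shows "(\<integral>\<^sup>+x. ennreal ((r * f x - r * g x)\<^sup>2) \<partial>N) = ennreal (r\<^sup>2) * (\<integral>\<^sup>+x. ennreal ((f x - g x)\<^sup>2) \<partial>N)"
  by (simp add: nn_integral_cmult[symmetric] ennreal_mult'[symmetric] power_mult_distrib[symmetric]
      right_diff_distrib)

lemma wiener_limit_scale:
  assumes W: "wiener_process M W" and fX: "wiener_limit M W t f X"
  shows "wiener_limit M W t (\<lambda>s. r * f s) (\<lambda>\<omega>. r * X \<omega>)"
proof (rule wiener_limit_closed[OF W])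
  note [measurable] = wiener_limit_measurable[OF fX]
  show "(\<lambda>s. r * f s) \<in> borel_measurable borel" "(\<lambda>\<omega>. r * X \<omega>) \<in> borel_measurable M"
    by measurable
  fix e :: real assume e: "0 < e"
  \<comment> \<open>Adding 1 keeps the divisor positive for \<open>r = 0\<close> and the resulting
    bound \<open>r\<^sup>2 * e'\<close> strictly below \<open>e\<close>.\<close>
  define e' where "e' = e / (r\<^sup>2 + 1)"
  have e': "0 < e'" using e by (simp add: e'_def add_nonneg_pos)
  from fX e' obtain \<phi> J where J: "elementary W t \<phi> J"
      "(\<integral>\<^sup>+s. ennreal ((f s - \<phi> s)\<^sup>2) \<partial>lborel) < ennreal e'"
      "(\<integral>\<^sup>+\<omega>. ennreal ((X \<omega> - J \<omega>)\<^sup>2) \<partial>M) < ennreal e'"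
    unfolding wiener_limit_def by blast
  note [measurable] = elementary_borel[OF J(1)] elementary_measurable[OF W J(1)]
  have less: "ennreal (r\<^sup>2) * x < ennreal e" if "x < ennreal e'" for x
  proof -
    have "ennreal (r\<^sup>2) * x \<le> ennreal (r\<^sup>2) * ennreal e'"
      using that by (intro mult_left_mono) auto
    also have "\<dots> = ennreal (r\<^sup>2 * e')" using e' by (simp add: ennreal_mult)
    also have "r\<^sup>2 * e' < e"
      using e add_nonneg_pos[of "r\<^sup>2" 1] by (simp add: e'_def divide_less_eq algebra_simps)
    then have "ennreal (r\<^sup>2 * e') < ennreal e" using e by (intro ennreal_lessI)
    finally show ?thesis .
  qed
  show "\<exists>g Y. wiener_limit M W t g Y \<and>
      (\<integral>\<^sup>+s. ennreal ((r * f s - g s)\<^sup>2) \<partial>lborel) < ennreal e \<and>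
      (\<integral>\<^sup>+\<omega>. ennreal ((r * X \<omega> - Y \<omega>)\<^sup>2) \<partial>M) < ennreal e"
    using less[OF J(2)] less[OF J(3)] wiener_limit_elementary[OF W elementary_scale[OF J(1), of r]]
    by (intro exI[of _ "\<lambda>s. r * \<phi> s"] exI[of _ "\<lambda>\<omega>. r * J \<omega>"]) (simp add: nn_integral_square_scale)
qed

lemma wiener_limit_add:
  assumes W: "wiener_process M W" and fX: "wiener_limit M W t f X" and gY: "wiener_limit M W t g Y"
  shows "wiener_limit M W t (\<lambda>s. f s + g s) (\<lambda>\<omega>. X \<omega> + Y \<omega>)"
proof (rule wiener_limit_closed[OF W])
  note [measurable] = wiener_limit_measurable[OF fX] wiener_limit_measurable[OF gY]
  show "(\<lambda>s. f s + g s) \<in> borel_measurable borel" "(\<lambda>\<omega>. X \<omega> + Y \<omega>) \<in> borel_measurable M"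
    by measurable
  fix e :: real assume e: "0 < e"
  then have e4: "0 < e / 4" by simp
  from fX e4 obtain \<phi> J where J: "elementary W t \<phi> J"
      "(\<integral>\<^sup>+s. ennreal ((f s - \<phi> s)\<^sup>2) \<partial>lborel) < ennreal (e / 4)"
      "(\<integral>\<^sup>+\<omega>. ennreal ((X \<omega> - J \<omega>)\<^sup>2) \<partial>M) < ennreal (e / 4)"
    unfolding wiener_limit_def by blast
  from gY e4 obtain \<psi> L where L: "elementary W t \<psi> L"
      "(\<integral>\<^sup>+s. ennreal ((g s - \<psi> s)\<^sup>2) \<partial>lborel) < ennreal (e / 4)"
      "(\<integral>\<^sup>+\<omega>. ennreal ((Y \<omega> - L \<omega>)\<^sup>2) \<partial>M) < ennreal (e / 4)"
    unfolding wiener_limit_def by blast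
  note [measurable] = elementary_borel[OF J(1)] elementary_measurable[OF W J(1)]
    elementary_borel[OF L(1)] elementary_measurable[OF W L(1)]
  \<comment> \<open>The intermediate function \<open>\<phi> + g\<close> changes one summand at a
    time; the first change contributes \<open>f - \<phi>\<close>, the second
    \<open>g - \<psi>\<close>.\<close>
  have "(\<integral>\<^sup>+s. ennreal ((f s + g s - (\<phi> s + \<psi> s))\<^sup>2) \<partial>lborel) < ennreal e"
    using nn_integral_square_diff_le[of "\<lambda>s. f s + g s" lborel "\<lambda>s. \<phi> s + g s" "\<lambda>s. \<phi> s + \<psi> s"]
      ennreal_double_sum_less[OF J(2) L(2) e] by simp
  moreover have "(\<integral>\<^sup>+\<omega>. ennreal ((X \<omega> + Y \<omega> - (J \<omega> + L \<omega>))\<^sup>2) \<partial>M) < ennreal e"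
    using nn_integral_square_diff_le[of "\<lambda>s. X s + Y s" M "\<lambda>s. J s + Y s" "\<lambda>s. J s + L s"]
      ennreal_double_sum_less[OF J(3) L(3) e] by simp
  ultimately show "\<exists>h Z. wiener_limit M W t h Z \<and>
      (\<integral>\<^sup>+s. ennreal ((f s + g s - h s)\<^sup>2) \<partial>lborel) < ennreal e \<and>
      (\<integral>\<^sup>+\<omega>. ennreal ((X \<omega> + Y \<omega> - Z \<omega>)\<^sup>2) \<partial>M) < ennreal e"
    using wiener_limit_elementary[OF W elementary_add[OF J(1) L(1)]] by blast
qed

lemma wiener_limit_diff:
  assumes "wiener_process M W" "wiener_limit M W t f X" "wiener_limit M W t g Y"
  shows "wiener_limit M W t (\<lambda>s. f s - g s) (\<lambda>\<omega>. X \<omega> - Y \<omega>)"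
  using wiener_limit_add[OF assms(1,2) wiener_limit_scale[OF assms(1,3), of "-1"]] by simp

lemma wiener_limit_sum:
  assumes W: "wiener_process M W" and "finite I" and "\<And>i. i \<in> I \<Longrightarrow> wiener_limit M W t (f i) (X i)"
  shows "wiener_limit M W t (\<lambda>s. \<Sum>i\<in>I. f i s) (\<lambda>\<omega>. \<Sum>i\<in>I. X i \<omega>)"
  using assms(2,3)
proof (induction I)
  case empty
  show ?case using wiener_limit_elementary[OF W elementary.zero] by simp
next
  case (insert i I)
  then show ?case using wiener_limit_add[OF W] by simp
qed

text \<open>A finite distance to some elementary pair suffices, so a single approximation with
  \<open>e = 1\<close> is used.\<close>

lemma wiener_limit_square_integrable:
  assumes W: "wiener_process M W" and fX: "wiener_limit M W t f X" and t: "0 \<le> t"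
  shows "integrable lborel (\<lambda>s. (f s)\<^sup>2)" "integrable M (\<lambda>\<omega>. (X \<omega>)\<^sup>2)"
proof -
  from fX obtain \<phi> J where J: "elementary W t \<phi> J"
      "(\<integral>\<^sup>+s. ennreal ((f s - \<phi> s)\<^sup>2) \<partial>lborel) < ennreal 1"
      "(\<integral>\<^sup>+\<omega>. ennreal ((X \<omega> - J \<omega>)\<^sup>2) \<partial>M) < ennreal 1"
    unfolding wiener_limit_def using zero_less_one by blast
  note [measurable] = wiener_limit_measurable[OF fX] elementary_borel[OF J(1)]
    elementary_measurable[OF W J(1)]
  show "integrable lborel (\<lambda>s. (f s)\<^sup>2)"
    using elementary_integrable[OF J(1) t] J(2)
    by (intro integrable_square_of_close[of f lborel \<phi>]) (auto intro: less_trans)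
  show "integrable M (\<lambda>\<omega>. (X \<omega>)\<^sup>2)"
    using elementary_moment[OF W J(1) t, of 1] J(3)
    by (intro integrable_square_of_close[of X M J]) (auto intro: less_trans simp: has_bochner_integral_iff)
qed

text \<open>Once square integrability is known, the \<open>nn_integral\<close> distances become
  Bochner integrals, the form used by \<open>has_wiener_integral\<close> and by
  \<open>tendsto_integral_square\<close>.\<close>

lemma wiener_limit_sequence:
  assumes W: "wiener_process M W" and fX: "wiener_limit M W t f X" and t: "0 \<le> t"
  obtains \<phi> J where "\<And>k::nat. elementary W t (\<phi> k) (J k)"
    "(\<lambda>k. LINT s|lborel. (f s - \<phi> k s)\<^sup>2) \<longlonglongrightarrow> 0"
    "(\<lambda>k. LINT \<omega>|M. (X \<omega> - J k \<omega>)\<^sup>2) \<longlonglongrightarrow> 0"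
proof -
  have "\<forall>k::nat. \<exists>\<phi> J. elementary W t \<phi> J \<and>
      (\<integral>\<^sup>+s. ennreal ((f s - \<phi> s)\<^sup>2) \<partial>lborel) < ennreal (1 / Suc k) \<and>
      (\<integral>\<^sup>+\<omega>. ennreal ((X \<omega> - J \<omega>)\<^sup>2) \<partial>M) < ennreal (1 / Suc k)"
  proof
    fix k :: nat
    have "0 < 1 / real (Suc k)" by simp
    with fX show "\<exists>\<phi> J. elementary W t \<phi> J \<and>
      (\<integral>\<^sup>+s. ennreal ((f s - \<phi> s)\<^sup>2) \<partial>lborel) < ennreal (1 / Suc k) \<and>
      (\<integral>\<^sup>+\<omega>. ennreal ((X \<omega> - J \<omega>)\<^sup>2) \<partial>M) < ennreal (1 / Suc k)"
      unfolding wiener_limit_def by blast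
  qed
  from choice[OF this] obtain \<phi> where "\<forall>k::nat. \<exists>J. elementary W t (\<phi> k) J \<and>
      (\<integral>\<^sup>+s. ennreal ((f s - \<phi> k s)\<^sup>2) \<partial>lborel) < ennreal (1 / Suc k) \<and>
      (\<integral>\<^sup>+\<omega>. ennreal ((X \<omega> - J \<omega>)\<^sup>2) \<partial>M) < ennreal (1 / Suc k)" ..
  from choice[OF this] obtain J where "\<forall>k::nat. elementary W t (\<phi> k) (J k) \<and>
      (\<integral>\<^sup>+s. ennreal ((f s - \<phi> k s)\<^sup>2) \<partial>lborel) < ennreal (1 / Suc k) \<and>
      (\<integral>\<^sup>+\<omega>. ennreal ((X \<omega> - J k \<omega>)\<^sup>2) \<partial>M) < ennreal (1 / Suc k)" ..
  then have J: "\<And>k. elementary W t (\<phi> k) (J k)"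
      and f: "\<And>k. (\<integral>\<^sup>+s. ennreal ((f s - \<phi> k s)\<^sup>2) \<partial>lborel) < ennreal (1 / Suc k)"
      and X: "\<And>k. (\<integral>\<^sup>+\<omega>. ennreal ((X \<omega> - J k \<omega>)\<^sup>2) \<partial>M) < ennreal (1 / Suc k)"
    by simp_all
  note sq = wiener_limit_square_integrable[OF W fX t]
  note [measurable] = wiener_limit_measurable[OF fX] elementary_borel[OF J]
    elementary_measurable[OF W J]
  have "norm (LINT s|lborel. (f s - \<phi> k s)\<^sup>2) \<le> 1 / Suc k" for k
    using f[of k] integrable_square_diff[of f lborel "\<phi> k"] sq elementary_integrable[OF J t, of k]
    by (simp add: nn_integral_eq_integral ennreal_less_iff)
  moreover have "norm (LINT \<omega>|M. (X \<omega> - J k \<omega>)\<^sup>2) \<le> 1 / Suc k" for k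
    using X[of k] integrable_square_diff[of X M "J k"] sq elementary_moment[OF W J t, of k 1]
    by (simp add: nn_integral_eq_integral ennreal_less_iff has_bochner_integral_iff)
  ultimately have bounds: "norm (LINT s|lborel. (f s - \<phi> k s)\<^sup>2) \<le> 1 / Suc k"
    "norm (LINT \<omega>|M. (X \<omega> - J k \<omega>)\<^sup>2) \<le> 1 / Suc k" for k
    by blast+
  note lim = LIMSEQ_inverse_real_of_nat[unfolded inverse_eq_divide]
  show ?thesis
    by (rule that[of \<phi> J, OF J Lim_null_comparison[OF always_eventually lim] Lim_null_comparison[OF always_eventually lim]])
      (use bounds in blast)+
qed

text \<open>For elementary pairs this is \<open>elementary_moment\<close> with \<open>k = 1\<close>;
  both sides are then limits of one and the same sequence of second moments.\<close>

lemma wiener_limit_isometry: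
  assumes W: "wiener_process M W" and fX: "wiener_limit M W t f X" and t: "0 \<le> t"
  shows "(LINT \<omega>|M. (X \<omega>)\<^sup>2) = (LINT s|lborel. (f s)\<^sup>2)"
proof -
  obtain \<phi> J where J: "\<And>k::nat. elementary W t (\<phi> k) (J k)"
    and lim: "(\<lambda>k. LINT s|lborel. (f s - \<phi> k s)\<^sup>2) \<longlonglongrightarrow> 0"
      "(\<lambda>k. LINT \<omega>|M. (X \<omega> - J k \<omega>)\<^sup>2) \<longlonglongrightarrow> 0"
    using wiener_limit_sequence[OF assms] by blast
  note sq = wiener_limit_square_integrable[OF W fX t]
  note [measurable] = wiener_limit_measurable[OF fX] elementary_borel[OF J]
    elementary_measurable[OF W J]
  note m = elementary_moment[OF W J t, where k = 1]
  have J2: "integrable M (\<lambda>\<omega>. (J k \<omega>)\<^sup>2)" "(LINT \<omega>|M. (J k \<omega>)\<^sup>2) = (LINT s|lborel. (\<phi> k s)\<^sup>2)" for k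
    using m[of k] by (simp_all add: has_bochner_integral_iff gaussian_moment_1[simplified])
  have "(\<lambda>k. LINT s|lborel. (\<phi> k s)\<^sup>2) \<longlonglongrightarrow> (LINT s|lborel. (f s)\<^sup>2)"
    using lim(1) sq elementary_integrable[OF J t] by (intro tendsto_integral_square) auto
  moreover have "(\<lambda>k. LINT \<omega>|M. (J k \<omega>)\<^sup>2) \<longlonglongrightarrow> (LINT \<omega>|M. (X \<omega>)\<^sup>2)"
    using lim(2) sq J2 by (intro tendsto_integral_square) auto
  ultimately show ?thesis unfolding J2 by (rule LIMSEQ_unique[symmetric])
qed

text \<open>Fatou's lemma along an almost surely convergent subsequence of elementary integrals.\<close>

lemma wiener_limit_moment:
  assumes W: "wiener_process M W" and fX: "wiener_limit M W t f X" and t: "0 \<le> t"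
  shows "(\<integral>\<^sup>+\<omega>. ennreal (X \<omega> ^ (2 * k)) \<partial>M) \<le> ennreal (gaussian_moment k * (LINT \<omega>|M. (X \<omega>)\<^sup>2) ^ k)"
proof -
  obtain \<phi> J where J: "\<And>k::nat. elementary W t (\<phi> k) (J k)"
    and lim: "(\<lambda>k. LINT s|lborel. (f s - \<phi> k s)\<^sup>2) \<longlonglongrightarrow> 0"
      "(\<lambda>k. LINT \<omega>|M. (X \<omega> - J k \<omega>)\<^sup>2) \<longlonglongrightarrow> 0"
    using wiener_limit_sequence[OF assms] by blast
  note sq = wiener_limit_square_integrable[OF W fX t]
  note [measurable] = wiener_limit_measurable[OF fX] elementary_borel[OF J]
    elementary_measurable[OF W J]
  have "integrable M (\<lambda>\<omega>. (X \<omega> - J k \<omega>)\<^sup>2)" for k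
    using sq elementary_moment[OF W J t, of k 1]
    by (intro integrable_square_diff) (auto simp: has_bochner_integral_iff)
  then obtain r :: "nat \<Rightarrow> nat" where r: "strict_mono r"
    and ae: "AE \<omega> in M. (\<lambda>n. (X \<omega> - J (r n) \<omega>)\<^sup>2) \<longlonglongrightarrow> 0"
    using tendsto_L1_AE_subseq[of M "\<lambda>k \<omega>. (X \<omega> - J k \<omega>)\<^sup>2"] lim(2) by auto
  have "(\<lambda>k. LINT s|lborel. (\<phi> k s)\<^sup>2) \<longlonglongrightarrow> (LINT s|lborel. (f s)\<^sup>2)"
    using lim(1) sq elementary_integrable[OF J t] by (intro tendsto_integral_square) auto
  from LIMSEQ_subseq_LIMSEQ[OF this r]
  have lim': "(\<lambda>n. ennreal (gaussian_moment k * (LINT s|lborel. (\<phi> (r n) s)\<^sup>2) ^ k))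
      \<longlonglongrightarrow> ennreal (gaussian_moment k * (LINT \<omega>|M. (X \<omega>)\<^sup>2) ^ k)"
    unfolding wiener_limit_isometry[OF assms] by (intro tendsto_intros) (simp add: comp_def)
  have "(\<integral>\<^sup>+\<omega>. ennreal (X \<omega> ^ (2 * k)) \<partial>M) = (\<integral>\<^sup>+\<omega>. liminf (\<lambda>n. ennreal (J (r n) \<omega> ^ (2 * k))) \<partial>M)"
  proof (rule nn_integral_cong_AE)
    show "AE \<omega> in M. ennreal (X \<omega> ^ (2 * k)) = liminf (\<lambda>n. ennreal (J (r n) \<omega> ^ (2 * k)))"
      using ae
    proof eventually_elim
      case (elim \<omega>)
      then have "(\<lambda>n. X \<omega> - J (r n) \<omega>) \<longlonglongrightarrow> 0"
        using tendsto_real_sqrt[OF elim] by (simp add: tendsto_rabs_zero_iff)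
      from tendsto_diff[OF tendsto_const[of "X \<omega>"] this]
      have "(\<lambda>n. J (r n) \<omega>) \<longlonglongrightarrow> X \<omega>" by simp
      then have "(\<lambda>n. ennreal (J (r n) \<omega> ^ (2 * k))) \<longlonglongrightarrow> ennreal (X \<omega> ^ (2 * k))"
        by (intro tendsto_intros)
      then show ?case by (intro lim_imp_Liminf[symmetric]) auto
    qed
  qed
  also have "\<dots> \<le> liminf (\<lambda>n. \<integral>\<^sup>+\<omega>. ennreal (J (r n) \<omega> ^ (2 * k)) \<partial>M)"
    by (rule nn_integral_liminf) simp
  also have "\<dots> = liminf (\<lambda>n. ennreal (gaussian_moment k * (LINT s|lborel. (\<phi> (r n) s)\<^sup>2) ^ k))"
  proof -
    have "(\<integral>\<^sup>+\<omega>. ennreal (J n \<omega> ^ (2 * k)) \<partial>M)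
        = ennreal (gaussian_moment k * (LINT s|lborel. (\<phi> n s)\<^sup>2) ^ k)" for n
      using elementary_moment[OF W J t, of n k]
      by (subst nn_integral_eq_integral) (auto simp: has_bochner_integral_iff)
    then show ?thesis by simp
  qed
  also have "\<dots> = ennreal (gaussian_moment k * (LINT \<omega>|M. (X \<omega>)\<^sup>2) ^ k)"
    using lim' by (intro lim_imp_Liminf) auto
  finally show ?thesis .
qed

text \<open>Elementary integrands vanish off \<open>{0..t}\<close>, so their distance to
  \<open>f\<close> over that interval is their distance on the line to \<open>f\<close> extended by
  zero. In the converse direction \<open>elementary_partition\<close> supplies the partitions that
  the definition asks for.\<close>

lemma has_wiener_integral_iff_wiener_limit:
  assumes W: "wiener_process M W" and t: "0 \<le> t"
  shows "has_wiener_integral M W t f X \<longleftrightarrow> wiener_limit M W t (\<lambda>s. indicator {0..t} s * f s) X"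
proof -
  let ?f = "\<lambda>s. indicator {0..t} s * f s"
  have meas: "set_borel_measurable lborel {0..t} f \<longleftrightarrow> ?f \<in> borel_measurable borel"
    by (simp add: set_borel_measurable_def)
  have sqint: "set_integrable lborel {0..t} (\<lambda>s. (f s)\<^sup>2) \<longleftrightarrow> integrable lborel (\<lambda>s. (?f s)\<^sup>2)"
    unfolding set_integrable_def
    by (intro Bochner_Integration.integrable_cong) (auto simp: indicator_def)
  have dist: "(LBINT s:{0..t}. (f s - \<phi> s)\<^sup>2) = (LINT s|lborel. (?f s - \<phi> s)\<^sup>2)"
    if "elementary W t \<phi> J" for \<phi> and J :: "'a \<Rightarrow> real"
    unfolding set_lebesgue_integral_def
    using elementary_zero_outside[OF that]
    by (intro Bochner_Integration.integral_cong) (auto simp: indicator_def)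
  show ?thesis
  proof
    assume L: "has_wiener_integral M W t f X"
    then obtain n p c where part: "\<And>k::nat. partition_of t (n k) (p k)"
      and lim: "(\<lambda>k. LBINT s:{0..t}. (f s - step_function (n k) (p k) (c k) s)\<^sup>2) \<longlonglongrightarrow> 0"
        "(\<lambda>k. LINT \<omega>|M. (X \<omega> - step_integral W (n k) (p k) (c k) \<omega>)\<^sup>2) \<longlonglongrightarrow> 0"
      unfolding has_wiener_integral_def by blast
    have f[measurable]: "?f \<in> borel_measurable borel" and X[measurable]: "X \<in> borel_measurable M"
      and sq: "integrable lborel (\<lambda>s. (?f s)\<^sup>2)" "integrable M (\<lambda>\<omega>. (X \<omega>)\<^sup>2)"
      using L by (auto simp: has_wiener_integral_def square_integrable_on_def meas sqint)
    show "wiener_limit M W t ?f X"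
      unfolding wiener_limit_def
    proof (intro conjI allI impI f X)
      fix e :: real assume e: "0 < e"
      have "eventually (\<lambda>k. (LBINT s:{0..t}. (f s - step_function (n k) (p k) (c k) s)\<^sup>2) < e \<and>
        (LINT \<omega>|M. (X \<omega> - step_integral W (n k) (p k) (c k) \<omega>)\<^sup>2) < e) sequentially"
        using order_tendstoD(2)[OF lim(1) e] order_tendstoD(2)[OF lim(2) e] by (rule eventually_conj)
      then obtain k where k: "(LBINT s:{0..t}. (f s - step_function (n k) (p k) (c k) s)\<^sup>2) < e"
        "(LINT \<omega>|M. (X \<omega> - step_integral W (n k) (p k) (c k) \<omega>)\<^sup>2) < e"
        by (auto simp: eventually_sequentially)
      define \<phi> where "\<phi> = step_function (n k) (p k) (c k)"
      define L where "L = step_integral W (n k) (p k) (c k)"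
      have el: "elementary W t \<phi> L"
        unfolding \<phi>_def L_def by (rule elementary_step_function[OF part])
      note [measurable] = elementary_borel[OF el] elementary_measurable[OF W el]
      have "(\<integral>\<^sup>+s. ennreal ((?f s - \<phi> s)\<^sup>2) \<partial>lborel) < ennreal e"
        using k(1)[folded \<phi>_def] e integrable_square_diff[of ?f lborel \<phi>] sq(1) elementary_integrable[OF el t]
        by (subst nn_integral_eq_integral) (auto simp: dist[OF el] ennreal_less_iff)
      moreover have "(\<integral>\<^sup>+\<omega>. ennreal ((X \<omega> - L \<omega>)\<^sup>2) \<partial>M) < ennreal e"
        using k(2)[folded L_def] e integrable_square_diff[of X M L] sq(2) elementary_moment[OF W el t, of 1]
        by (subst nn_integral_eq_integral) (auto simp: ennreal_less_iff has_bochner_integral_iff)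
      ultimately show "\<exists>\<phi> J. elementary W t \<phi> J \<and>
          (\<integral>\<^sup>+s. ennreal ((?f s - \<phi> s)\<^sup>2) \<partial>lborel) < ennreal e \<and>
          (\<integral>\<^sup>+\<omega>. ennreal ((X \<omega> - J \<omega>)\<^sup>2) \<partial>M) < ennreal e"
        using el by blast
    qed
  next
    assume R: "wiener_limit M W t ?f X"
    obtain \<phi> J where J: "\<And>k::nat. elementary W t (\<phi> k) (J k)"
      and lim: "(\<lambda>k. LINT s|lborel. (?f s - \<phi> k s)\<^sup>2) \<longlonglongrightarrow> 0"
        "(\<lambda>k. LINT \<omega>|M. (X \<omega> - J k \<omega>)\<^sup>2) \<longlonglongrightarrow> 0"
      using wiener_limit_sequence[OF W R t] by blast
    have "\<forall>k. \<exists>n p c. partition_of t n p \<and> \<phi> k = step_function n p c \<and> J k = step_integral W n p c"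
      using elementary_partition[OF J t] by metis
    then obtain n p c where part: "\<And>k. partition_of t (n k) (p k)"
      and eq: "\<And>k. \<phi> k = step_function (n k) (p k) (c k)" "\<And>k. J k = step_integral W (n k) (p k) (c k)"
      by metis
    have "(\<lambda>k. LBINT s:{0..t}. (f s - \<phi> k s)\<^sup>2) \<longlonglongrightarrow> 0"
      using lim(1) by (simp add: dist[OF J])
    with lim(2) part wiener_limit_measurable[OF R] wiener_limit_square_integrable[OF W R t]
    show "has_wiener_integral M W t f X"
      unfolding has_wiener_integral_def square_integrable_on_def meas sqint eq by blast
  qed
qed


section \<open>Mean-square Riemann sums\<close>

text \<open>Cauchy-Schwarz against the constant 1 on \<open>{0<..t}\<close>, obtained from the
  nonnegativity of the variance of \<open>g\<close> on that interval.\<close>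

lemma square_integral_le_interval:
  fixes g :: "real \<Rightarrow> real"
  assumes [measurable]: "g \<in> borel_measurable borel" and t: "0 \<le> t"
    and zero: "\<And>s. s \<notin> {0<..t} \<Longrightarrow> g s = 0"
    and fin: "(\<integral>\<^sup>+s. ennreal ((g s)\<^sup>2) \<partial>lborel) < \<infinity>"
  shows "integrable lborel g"
    and "ennreal ((LINT s|lborel. g s)\<^sup>2) \<le> ennreal t * (\<integral>\<^sup>+s. ennreal ((g s)\<^sup>2) \<partial>lborel)"
proof -
  have g2: "integrable lborel (\<lambda>s. (g s)\<^sup>2)"
    using fin by (intro integrableI_nonneg) auto
  have ind: "integrable lborel (indicator {0<..t} :: real \<Rightarrow> real)"
    using t by (simp add: integrable_indicator_iff)
  show g1: "integrable lborel g"
  proof (rule Bochner_Integration.integrable_bound)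
    show "integrable lborel (\<lambda>s. indicator {0<..t} s + (g s)\<^sup>2 :: real)"
      using ind g2 by (rule Bochner_Integration.integrable_add)
    show "AE s in lborel. norm (g s) \<le> norm (indicator {0<..t} s + (g s)\<^sup>2 :: real)"
    proof (intro AE_I2)
      fix s
      have "\<bar>g s\<bar> \<le> 1 + (g s)\<^sup>2"
        using zero_le_power2[of "\<bar>g s\<bar> - 1"] by (simp add: power2_diff)
      then show "norm (g s) \<le> norm (indicator {0<..t} s + (g s)\<^sup>2 :: real)"
        using zero[of s] by (cases "s \<in> {0<..t}") auto
    qed
  qed simp
  define I where "I = (LINT s|lborel. g s)"
  have "I\<^sup>2 \<le> t * (LINT s|lborel. (g s)\<^sup>2)"
  proof (cases "t = 0")
    case True
    then have "g = (\<lambda>_. 0)" using zero by auto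
    then show ?thesis by (simp add: I_def)
  next
    case False
    \<comment> \<open>The mean value of \<open>g\<close>; this choice minimises the integral
      expanded below.\<close>
    define m where "m = I / t"
    have "0 \<le> (LINT s|lborel. (g s - m * indicator {0<..t} s)\<^sup>2)" by simp
    also have "\<dots> = (LINT s|lborel. (g s)\<^sup>2 - 2 * m * g s + m\<^sup>2 * indicator {0<..t} s)"
      using zero by (intro Bochner_Integration.integral_cong)
        (auto simp: indicator_def power2_diff power_mult_distrib)
    also have "\<dots> = (LINT s|lborel. (g s)\<^sup>2) - 2 * m * I + m\<^sup>2 * t"
      using g1 g2 ind t by (simp add: I_def)
    also have "\<dots> = (LINT s|lborel. (g s)\<^sup>2) - I\<^sup>2 / t"
      using False by (simp add: m_def power2_eq_square)
    finally show ?thesis using False t by (simp add: field_simps)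
  qed
  then show "ennreal ((LINT s|lborel. g s)\<^sup>2) \<le> ennreal t * (\<integral>\<^sup>+s. ennreal ((g s)\<^sup>2) \<partial>lborel)"
    using g2 t by (simp add: I_def nn_integral_eq_integral flip: ennreal_mult)
qed

lemma step_function_const:
  assumes "\<And>i. i < n \<Longrightarrow> p i \<le> p (Suc i)"
  shows "step_function n p (\<lambda>_. c) s = c * indicator {p 0<..p n} s"
proof -
  have "p 0 \<le> p n"
    using assms by (induction n) (auto intro: order_trans)
  then show ?thesis
    using sum_lessThan_telescope[of "\<lambda>i. of_bool (s \<le> p i) :: real" n] assms
    by (simp add: step_functionI indicator_half_open_diff sum_distrib_left[symmetric])
qed

text \<open>
  The error of the Riemann sum is the integral of \<open>D s x = G (p j) x - G s x\<close>, where \<open>j\<close> is the index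
  of the cell containing \<open>s\<close>; as a step function with \<open>s\<close>-dependent coefficients, \<open>D\<close> squares cellwise.
\<close>

lemma riemann_sum_mean_square:
  fixes G :: "real \<Rightarrow> 'b \<Rightarrow> real"
  assumes "sigma_finite_measure N"
    and G: "(\<lambda>(s, x). G s x) \<in> borel_measurable (lborel \<Otimes>\<^sub>M N)"
    and t: "0 \<le> t" and n: "0 < n"
    and bound: "\<And>s s'. s \<in> {0..t} \<Longrightarrow> s' \<in> {0..t} \<Longrightarrow> \<bar>s - s'\<bar> \<le> t / real n \<Longrightarrow>
      (\<integral>\<^sup>+x. ennreal ((G s x - G s' x)\<^sup>2) \<partial>N) \<le> e"
  shows "(\<integral>\<^sup>+x. ennreal (((\<Sum>j<n. t / real n * G (real j * t / real n) x)
      - (LINT s|lborel. indicator {0<..t} s * G s x))\<^sup>2) \<partial>N) \<le> ennreal t * (ennreal t * e)"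
proof -
  interpret N: sigma_finite_measure N by fact
  interpret P: pair_sigma_finite lborel N ..
  note [measurable] = G
  define p where "p j = real j * t / real n" for j :: nat
  have p: "p j \<le> p (Suc j)" for j using t n by (simp add: p_def divide_right_mono mult_right_mono)
  have p0n: "p 0 = 0" "p n = t" using n by (auto simp: p_def)
  have dp: "p (Suc j) - p j = t / real n" for j by (simp add: p_def add_divide_distrib distrib_right)
  have part: "partition_of t n p" using p p0n by (simp add: partition_of_def)
  have Gs[measurable]: "G s \<in> borel_measurable N" for s
    using measurable_Pair2[OF G, of s] by simp
  have Gx: "(\<lambda>s. G s x) \<in> borel_measurable borel" if "x \<in> space N" for x
    using measurable_Pair1[OF G that] by simp
  define D where "D s x = step_function n p (\<lambda>j. G (p j) x - G s x) s" for s x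
  have D_eq: "D s x = step_function n p (\<lambda>j. G (p j) x) s - indicator {0<..t} s * G s x" for s x
    using step_function_const[of n p "G s x" s] p p0n
    by (simp add: D_def step_function_def left_diff_distrib sum_subtractf mult.commute)
  have D2: "(D s x)\<^sup>2 = (\<Sum>j<n. (G (p j) x - G s x)\<^sup>2 * indicator {p j<..p (Suc j)} s)" for s x
    unfolding D_def by (subst step_function_square) (simp_all add: p step_function_def)
  have D2_meas: "(\<lambda>(s, x). ennreal ((D s x)\<^sup>2)) \<in> borel_measurable (lborel \<Otimes>\<^sub>M N)"
    unfolding D2 by measurable
  have "(\<integral>\<^sup>+x. ennreal (((\<Sum>j<n. t / real n * G (real j * t / real n) x)
      - (LINT s|lborel. indicator {0<..t} s * G s x))\<^sup>2) \<partial>N)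
      \<le> (\<integral>\<^sup>+x. ennreal t * (\<integral>\<^sup>+s. ennreal ((D s x)\<^sup>2) \<partial>lborel) \<partial>N)"
  proof (intro nn_integral_mono)
    fix x assume x: "x \<in> space N"
    note [measurable] = Gx[OF x]
    have D_meas: "(\<lambda>s. D s x) \<in> borel_measurable borel"
      unfolding D_eq step_function_def by measurable
    have D_zero: "D s x = 0" if "s \<notin> {0<..t}" for s
    proof -
      have "s \<notin> {p j<..p (Suc j)}" if "j < n" for j
        using partition_of_bounds[OF part, of j "Suc j"] that \<open>s \<notin> {0<..t}\<close> by auto
      then show ?thesis by (simp add: D_def step_function_def)
    qed
    show "ennreal (((\<Sum>j<n. t / real n * G (real j * t / real n) x)
        - (LINT s|lborel. indicator {0<..t} s * G s x))\<^sup>2)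
        \<le> ennreal t * (\<integral>\<^sup>+s. ennreal ((D s x)\<^sup>2) \<partial>lborel)"
    \<comment> \<open>Where the inner integral is infinite the bound is trivial; this disposes of
      those \<open>x\<close> for which \<open>G\<close> need not be integrable in \<open>s\<close>
      and the Bochner integral may be its default 0.\<close>
    proof (cases "(\<integral>\<^sup>+s. ennreal ((D s x)\<^sup>2) \<partial>lborel) < \<infinity>")
      case True
      have S: "has_bochner_integral lborel (step_function n p (\<lambda>j. G (p j) x))
          (\<Sum>j<n. G (p j) x * (p (Suc j) - p j))"
        using p by (intro has_bochner_integral_step_function)
      have sum_eq: "(\<Sum>j<n. t / real n * G (real j * t / real n) x) = (\<Sum>j<n. G (p j) x * (p (Suc j) - p j))"
        unfolding dp by (simp add: p_def mult.commute)
      note CS = square_integral_le_interval[OF D_meas t D_zero True]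
      \<comment> \<open>Integrability of \<open>G\<close> in \<open>s\<close> is not assumed but
        recovered: on \<open>{0<..t}\<close> it is a step function minus \<open>D\<close>.\<close>
      have "integrable lborel (\<lambda>s. step_function n p (\<lambda>j. G (p j) x) s - D s x)"
        using S CS(1) by (intro Bochner_Integration.integrable_diff) (auto simp: has_bochner_integral_iff)
      then have "integrable lborel (\<lambda>s. indicator {0<..t} s * G s x)"
        by (simp add: D_eq)
      then have "(LINT s|lborel. D s x) = (\<Sum>j<n. t / real n * G (real j * t / real n) x)
        - (LINT s|lborel. indicator {0<..t} s * G s x)"
        using S unfolding D_eq sum_eq by (simp add: has_bochner_integral_iff)
      then show ?thesis using CS(2) by simp
    next
      case False
      then have inf: "(\<integral>\<^sup>+s. ennreal ((D s x)\<^sup>2) \<partial>lborel) = \<infinity>"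
        by (simp add: not_less top_unique)
      \<comment> \<open>\<open>t = 0\<close> would annihilate the infinite factor, but in that case
        \<open>D\<close> is zero.\<close>
      then have "t \<noteq> 0" using D_zero by auto
      with t have "ennreal t * (\<integral>\<^sup>+s. ennreal ((D s x)\<^sup>2) \<partial>lborel) = \<infinity>"
        unfolding inf by (simp add: ennreal_mult_eq_top_iff)
      then show ?thesis by simp
    qed
  qed
  also have "\<dots> = ennreal t * (\<integral>\<^sup>+x. (\<integral>\<^sup>+s. ennreal ((D s x)\<^sup>2) \<partial>lborel) \<partial>N)"
    using measurable_pair_swap[OF D2_meas]
    by (intro nn_integral_cmult lborel.borel_measurable_nn_integral) simp
  also have "\<dots> \<le> ennreal t * (ennreal t * e)"
  proof (rule mult_left_mono)
    \<comment> \<open>Tonelli moves the integral over \<open>x\<close> inside, where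
      \<open>bound\<close> applies at every fixed \<open>s\<close>: the cell containing
      \<open>s\<close> has length \<open>t / n\<close>.\<close>
    have "(\<integral>\<^sup>+x. (\<integral>\<^sup>+s. ennreal ((D s x)\<^sup>2) \<partial>lborel) \<partial>N) = (\<integral>\<^sup>+s. (\<integral>\<^sup>+x. ennreal ((D s x)\<^sup>2) \<partial>N) \<partial>lborel)"
      using D2_meas by (intro P.Fubini') simp
    also have "\<dots> \<le> (\<integral>\<^sup>+s. e * indicator {0<..t} s \<partial>lborel)"
    proof (intro nn_integral_mono)
      fix s
      have D2s: "ennreal ((D s x)\<^sup>2) = (\<Sum>j<n. ennreal ((G (p j) x - G s x)\<^sup>2) * indicator {p j<..p (Suc j)} s)" for x
        unfolding D2 by (subst sum_ennreal[symmetric]) (simp_all add: ennreal_mult' ennreal_indicator)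
      have "(\<integral>\<^sup>+x. ennreal ((D s x)\<^sup>2) \<partial>N)
          = (\<Sum>j<n. \<integral>\<^sup>+x. ennreal ((G (p j) x - G s x)\<^sup>2) * indicator {p j<..p (Suc j)} s \<partial>N)"
        unfolding D2s by (rule nn_integral_sum) measurable
      also have "\<dots> \<le> (\<Sum>j<n. e * indicator {p j<..p (Suc j)} s)"
      proof (rule sum_mono)
        fix j assume j: "j \<in> {..<n}"
        have "(\<integral>\<^sup>+x. ennreal ((G (p j) x - G s x)\<^sup>2) \<partial>N) \<le> e" if "s \<in> {p j<..p (Suc j)}"
          using partition_of_bounds[OF part, of j "Suc j"] j that dp[of j] by (intro bound) auto
        then show "(\<integral>\<^sup>+x. ennreal ((G (p j) x - G s x)\<^sup>2) * indicator {p j<..p (Suc j)} s \<partial>N)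
            \<le> e * indicator {p j<..p (Suc j)} s"
          by (cases "s \<in> {p j<..p (Suc j)}") auto
      qed
      also have "\<dots> = e * ennreal (step_function n p (\<lambda>_. 1) s)"
        unfolding step_function_def
        by (subst sum_ennreal[symmetric]) (simp_all add: sum_distrib_left ennreal_indicator)
      also have "\<dots> = e * indicator {0<..t} s"
        using step_function_const[of n p 1 s] p p0n by (simp add: ennreal_indicator)
      finally show "(\<integral>\<^sup>+x. ennreal ((D s x)\<^sup>2) \<partial>N) \<le> e * indicator {0<..t} s" .
    qed
    also have "\<dots> = e * ennreal t"
      using t by (simp add: nn_integral_cmult_indicator)
    finally show "(\<integral>\<^sup>+x. (\<integral>\<^sup>+s. ennreal ((D s x)\<^sup>2) \<partial>lborel) \<partial>N) \<le> ennreal t * e"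
      by (simp only: mult.commute)
  qed simp
  finally show ?thesis .
qed

text \<open>Transfers the mean-square modulus of continuity of a process to its kernels.\<close>

lemma wiener_limit_distance:
  assumes W: "wiener_process M W" and t: "0 \<le> t"
    and fX: "wiener_limit M W t f X" and gY: "wiener_limit M W t g Y"
  shows "(\<integral>\<^sup>+s. ennreal ((f s - g s)\<^sup>2) \<partial>lborel) = (\<integral>\<^sup>+\<omega>. ennreal ((X \<omega> - Y \<omega>)\<^sup>2) \<partial>M)"
proof -
  note d = wiener_limit_diff[OF W fX gY]
  show ?thesis
    using wiener_limit_square_integrable[OF W d t] wiener_limit_isometry[OF W d t]
    by (simp add: nn_integral_eq_integral)
qed

section \<open>Stochastic Fubini theorem\<close>

lemma wiener_limit_integral:
  fixes k :: "real \<Rightarrow> real \<Rightarrow> real" and X :: "real \<Rightarrow> 'a \<Rightarrow> real"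
  assumes W: "wiener_process M W" and t: "0 \<le> t"
    and k[measurable]: "(\<lambda>(s, u). k s u) \<in> borel_measurable (lborel \<Otimes>\<^sub>M lborel)"
    and X[measurable]: "(\<lambda>(s, \<omega>). X s \<omega>) \<in> borel_measurable (lborel \<Otimes>\<^sub>M M)"
    and kX: "\<And>s. s \<in> {0..t} \<Longrightarrow> wiener_limit M W t (k s) (X s)"
    and cont: "\<And>e. 0 < e \<Longrightarrow> \<exists>h>0. \<forall>s\<in>{0..t}. \<forall>s'\<in>{0..t}. \<bar>s - s'\<bar> \<le> h \<longrightarrow>
      (\<integral>\<^sup>+\<omega>. ennreal ((X s \<omega> - X s' \<omega>)\<^sup>2) \<partial>M) \<le> ennreal e"
  shows "wiener_limit M W t (\<lambda>u. LINT s|lborel. indicator {0<..t} s * k s u)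
    (\<lambda>\<omega>. LINT s|lborel. indicator {0<..t} s * X s \<omega>)"
proof (rule wiener_limit_closed[OF W])
  interpret prob_space M using W by (simp add: wiener_process_def)
  show k_meas: "(\<lambda>u. LINT s|lborel. indicator {0<..t} s * k s u) \<in> borel_measurable borel"
  proof -
    have "(\<lambda>u. LINT s|lborel. indicator {0<..t} s * k s u) \<in> borel_measurable lborel"
      by (rule lborel.borel_measurable_lebesgue_integral) measurable
    then show ?thesis by simp
  qed
  show X_meas: "(\<lambda>\<omega>. LINT s|lborel. indicator {0<..t} s * X s \<omega>) \<in> borel_measurable M"
    by (rule lborel.borel_measurable_lebesgue_integral) measurable
  fix e :: real assume e: "0 < e"
  \<comment> \<open>The Riemann error is at most \<open>t\<^sup>2 * e'\<close>; the added 1 makes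
    this strictly smaller than \<open>e\<close> and allows \<open>t = 0\<close>.\<close>
  define e' where "e' = e / (t\<^sup>2 + 1)"
  have t2: "0 < t\<^sup>2 + 1" by (simp add: add_nonneg_pos)
  then have e': "0 < e'" using e by (simp add: e'_def)
  have less: "ennreal t * (ennreal t * ennreal e') < ennreal e"
  proof -
    have "t * (t * e') < e"
      using e t2 by (simp add: e'_def divide_less_eq power2_eq_square algebra_simps)
    then have "ennreal (t * (t * e')) < ennreal e" using e by (intro ennreal_lessI)
    then show ?thesis using t e' by (simp add: ennreal_mult)
  qed
  from cont[OF e'] obtain h where h: "0 < h"
    and Xh: "\<And>s s'. s \<in> {0..t} \<Longrightarrow> s' \<in> {0..t} \<Longrightarrow> \<bar>s - s'\<bar> \<le> h \<Longrightarrow>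
      (\<integral>\<^sup>+\<omega>. ennreal ((X s \<omega> - X s' \<omega>)\<^sup>2) \<partial>M) \<le> ennreal e'"
    by blast
  define n where "n = Suc (nat \<lceil>t / h\<rceil>)"
  have n: "0 < n" by (simp add: n_def)
  have "t / h \<le> real n" unfolding n_def by linarith
  then have tn: "t / real n \<le> h" using h n by (simp add: field_simps)
  \<comment> \<open>By the isometry the same \<open>h\<close> serves the kernels, so no continuity
    of \<open>k\<close> in \<open>s\<close> is assumed.\<close>
  have kh: "(\<integral>\<^sup>+u. ennreal ((k s u - k s' u)\<^sup>2) \<partial>lborel) \<le> ennreal e'"
    if "s \<in> {0..t}" "s' \<in> {0..t}" "\<bar>s - s'\<bar> \<le> h" for s s'
    using Xh[OF that] wiener_limit_distance[OF W t kX kX, OF that(1,2)] by simp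
  let ?f = "\<lambda>u. \<Sum>j<n. t / real n * k (real j * t / real n) u"
  let ?Y = "\<lambda>\<omega>. \<Sum>j<n. t / real n * X (real j * t / real n) \<omega>"
  have "real j * t / real n \<in> {0..t}" if "j < n" for j
  proof -
    have "real j * t \<le> real n * t" using that t by (intro mult_right_mono) auto
    then show ?thesis using t n by (simp add: field_simps)
  qed
  then have RS: "wiener_limit M W t ?f ?Y"
    by (intro wiener_limit_sum[OF W] wiener_limit_scale[OF W] kX) auto
  have swap: "(a - b)\<^sup>2 = (b - a)\<^sup>2" for a b :: real by (rule power2_commute)
  have "(\<integral>\<^sup>+u. ennreal (((LINT s|lborel. indicator {0<..t} s * k s u) - ?f u)\<^sup>2) \<partial>lborel) < ennreal e"
    using riemann_sum_mean_square[OF lborel.sigma_finite_measure_axioms k t n kh] tn less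
    by (subst swap) (auto intro: le_less_trans)
  moreover have "(\<integral>\<^sup>+\<omega>. ennreal (((LINT s|lborel. indicator {0<..t} s * X s \<omega>) - ?Y \<omega>)\<^sup>2) \<partial>M) < ennreal e"
    using riemann_sum_mean_square[OF sigma_finite_measure_axioms X t n Xh] tn less
    by (subst swap) (auto intro: le_less_trans)
  ultimately show "\<exists>g Y. wiener_limit M W t g Y \<and>
      (\<integral>\<^sup>+u. ennreal (((LINT s|lborel. indicator {0<..t} s * k s u) - g u)\<^sup>2) \<partial>lborel) < ennreal e \<and>
      (\<integral>\<^sup>+\<omega>. ennreal (((LINT s|lborel. indicator {0<..t} s * X s \<omega>) - Y \<omega>)\<^sup>2) \<partial>M) < ennreal e"
    using RS by blast
qed

section \<open>Joint measurability of continuous processes\<close>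

text \<open>Along the grid of mesh \<open>1 / Suc n\<close> the process is sampled at left end
  points, which is a countable case distinction over the integer index and hence jointly measurable;
  path continuity gives the limit.\<close>

lemma continuous_process_jointly_measurable:
  fixes Y :: "real \<Rightarrow> 'a \<Rightarrow> real"
  assumes Y: "\<And>s. Y s \<in> borel_measurable M"
    and cont: "\<And>\<omega>. \<omega> \<in> space M \<Longrightarrow> continuous_on UNIV (\<lambda>s. Y s \<omega>)"
  shows "(\<lambda>(s, \<omega>). Y s \<omega>) \<in> borel_measurable (lborel \<Otimes>\<^sub>M M)"
proof (rule borel_measurable_LIMSEQ_real)
  show "(\<lambda>z. case z of (s, \<omega>) \<Rightarrow> Y (real_of_int \<lfloor>real (Suc n) * s\<rfloor> / real (Suc n)) \<omega>)
      \<in> borel_measurable (lborel \<Otimes>\<^sub>M M)" for n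
  proof -
    have "(\<lambda>z. (\<lambda>i z. Y (real_of_int i / real (Suc n)) (snd z)) \<lfloor>real (Suc n) * fst z\<rfloor> z)
        \<in> borel_measurable (lborel \<Otimes>\<^sub>M M)"
    proof (rule measurable_compose_countable[where f = "\<lambda>i z. Y (real_of_int i / real (Suc n)) (snd z)"])
      show "(\<lambda>z. Y (real_of_int i / real (Suc n)) (snd z)) \<in> borel_measurable (lborel \<Otimes>\<^sub>M M)" for i
        using Y by (rule measurable_compose[OF measurable_snd])
      show "(\<lambda>z. \<lfloor>real (Suc n) * fst z\<rfloor>) \<in> measurable (lborel \<Otimes>\<^sub>M M) (count_space UNIV)"
        by measurable
    qed
    then show ?thesis by (simp add: case_prod_beta)
  qed
  fix z :: "real \<times> 'a" assume z: "z \<in> space (lborel \<Otimes>\<^sub>M M)"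
  obtain s \<omega> where s\<omega>: "z = (s, \<omega>)" by (cases z)
  have "(\<lambda>n. real_of_int \<lfloor>real (Suc n) * s\<rfloor> / real (Suc n) - s) \<longlonglongrightarrow> 0"
  proof (rule Lim_null_comparison[OF always_eventually LIMSEQ_inverse_real_of_nat[unfolded inverse_eq_divide]], rule allI)
    show "norm (real_of_int \<lfloor>real (Suc n) * s\<rfloor> / real (Suc n) - s) \<le> 1 / real (Suc n)" for n
    proof -
      have *: "\<bar>real_of_int \<lfloor>k * s\<rfloor> / k - s\<bar> \<le> 1 / k" if "0 < k" for k
      proof -
        have "\<bar>real_of_int \<lfloor>k * s\<rfloor> - k * s\<bar> \<le> 1" by linarith
        moreover have "real_of_int \<lfloor>k * s\<rfloor> / k - s = (real_of_int \<lfloor>k * s\<rfloor> - k * s) / k"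
          using that by (simp add: diff_divide_distrib)
        ultimately show ?thesis using that by (simp add: abs_divide divide_right_mono)
      qed
      show ?thesis using *[of "real (Suc n)"] by (simp del: of_nat_Suc)
    qed
  qed
  then have "(\<lambda>n. real_of_int \<lfloor>real (Suc n) * s\<rfloor> / real (Suc n)) \<longlonglongrightarrow> s"
    by (simp only: LIM_zero_iff)
  moreover have "isCont (\<lambda>s. Y s \<omega>) s"
    using cont[of \<omega>] z by (simp add: s\<omega> space_pair_measure continuous_on_eq_continuous_at)
  ultimately have "(\<lambda>n. Y (real_of_int \<lfloor>real (Suc n) * s\<rfloor> / real (Suc n)) \<omega>) \<longlonglongrightarrow> Y s \<omega>"
    by (rule isCont_tendsto_compose[rotated])
  then show "(\<lambda>n. case z of (s, \<omega>) \<Rightarrow> Y (real_of_int \<lfloor>real (Suc n) * s\<rfloor> / real (Suc n)) \<omega>)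
      \<longlonglongrightarrow> (case z of (s, \<omega>) \<Rightarrow> Y s \<omega>)"
    by (simp only: s\<omega> prod.case)
qed


section \<open>Kolmogorov's continuity theorem\<close>

definition dyadic_floor :: "real \<Rightarrow> nat \<Rightarrow> real \<Rightarrow> real" where
  "dyadic_floor T n t = real (nat \<lfloor>2 ^ n * t / T\<rfloor>) * T / 2 ^ n"

context
  fixes T :: real assumes T: "0 < T"
begin

text \<open>At \<open>t = T\<close> the index is \<open>2 ^ n\<close> itself, so level
  \<open>n\<close> has \<open>2 ^ n + 1\<close> grid points and \<open>2 ^ n\<close>
  increments.\<close>

lemma dyadic_floor_index:
  assumes "t \<in> {0..T}"
  shows "nat \<lfloor>2 ^ n * t / T\<rfloor> \<le> 2 ^ n"
proof -
  have "2 ^ n * t / T \<le> 2 ^ n" using assms T by (simp add: field_simps)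
  then have "\<lfloor>2 ^ n * t / T\<rfloor> \<le> \<lfloor>2 ^ n :: real\<rfloor>" by (rule floor_mono)
  then show ?thesis by (simp add: nat_le_iff)
qed

lemma dyadic_floor_bounds:
  assumes "t \<in> {0..T}"
  shows "dyadic_floor T n t \<in> {0..T}" "dyadic_floor T n t \<le> t" "t - dyadic_floor T n t \<le> T / 2 ^ n"
proof -
  have pos: "0 \<le> 2 ^ n * t / T" using assms T by simp
  have "real (nat \<lfloor>2 ^ n * t / T\<rfloor>) \<le> 2 ^ n * t / T"
    using pos by (simp add: of_nat_nat)
  then show le: "dyadic_floor T n t \<le> t" using T by (simp add: dyadic_floor_def field_simps)
  have "2 ^ n * t / T \<le> real (nat \<lfloor>2 ^ n * t / T\<rfloor>) + 1"
    using pos by (simp add: of_nat_nat)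
  then have "t \<le> (real (nat \<lfloor>2 ^ n * t / T\<rfloor>) + 1) * T / 2 ^ n"
    using T by (simp add: pos_le_divide_eq pos_divide_le_eq mult.commute)
  then show "t - dyadic_floor T n t \<le> T / 2 ^ n"
    by (simp add: dyadic_floor_def add_divide_distrib distrib_right)
  show "dyadic_floor T n t \<in> {0..T}" using le assms T by (simp add: dyadic_floor_def)
qed

section \<open>A single path with geometrically small dyadic increments\<close>

context
  fixes z :: "real \<Rightarrow> real" and B r :: real
  assumes r: "0 \<le> r" "r < 1"
    and incr: "\<And>n i. i < 2 ^ n \<Longrightarrow> \<bar>z (real (Suc i) * T / 2 ^ n) - z (real i * T / 2 ^ n)\<bar> \<le> B * r ^ n"
begin

lemma dyadic_bound_nonneg: "0 \<le> B"
  using incr[of 0 0] by simp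

text \<open>Doubling \<open>y\<close> makes the floor either twice the old one or one more, so
  refining keeps the grid point or moves it by one fine step.\<close>

lemma dyadic_refinement_bound:
  assumes "t \<in> {0..T}"
  shows "\<bar>z (dyadic_floor T (Suc n) t) - z (dyadic_floor T n t)\<bar> \<le> B * r ^ Suc n"
proof -
  define y where "y = 2 ^ n * t / T"
  define i where "i = nat \<lfloor>y\<rfloor>"
  have y: "0 \<le> y" "2 ^ Suc n * t / T = 2 * y" using assms T by (auto simp: y_def)
  have fl: "dyadic_floor T n t = real (2 * i) * T / 2 ^ Suc n"
    by (simp add: dyadic_floor_def y_def i_def)
  consider "nat \<lfloor>2 * y\<rfloor> = 2 * i" | "nat \<lfloor>2 * y\<rfloor> = Suc (2 * i)"
    unfolding i_def using y(1) by linarith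
  then show ?thesis
  proof cases
    case 1
    then have "dyadic_floor T (Suc n) t = dyadic_floor T n t"
      unfolding fl unfolding dyadic_floor_def y(2) by simp
    then show ?thesis using dyadic_bound_nonneg r by simp
  next
    case 2
    then have eq: "dyadic_floor T (Suc n) t = real (Suc (2 * i)) * T / 2 ^ Suc n"
      unfolding dyadic_floor_def y(2) by simp
    have "Suc (2 * i) \<le> 2 ^ Suc n"
      using dyadic_floor_index[OF assms, of "Suc n"] unfolding y(2) 2 .
    then show ?thesis unfolding eq fl by (intro incr) simp
  qed
qed

text \<open>Two points less than one mesh width apart have equal or adjacent left grid
  points.\<close>

lemma dyadic_close_bound:
  assumes s: "s \<in> {0..T}" and t: "t \<in> {0..T}" and st: "\<bar>t - s\<bar> < T / 2 ^ n"
  shows "\<bar>z (dyadic_floor T n t) - z (dyadic_floor T n s)\<bar> \<le> B * r ^ n"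
proof -
  have *: "\<bar>z (dyadic_floor T n t) - z (dyadic_floor T n s)\<bar> \<le> B * r ^ n"
    if s: "s \<in> {0..T}" and t: "t \<in> {0..T}" and "s \<le> t" "t - s < T / 2 ^ n" for s t
  proof -
    define x y where "x = 2 ^ n * s / T" and "y = 2 ^ n * t / T"
    have xy: "0 \<le> x" "x \<le> y" "y < x + 1"
      using that T by (auto simp: x_def y_def field_simps)
    then consider "nat \<lfloor>y\<rfloor> = nat \<lfloor>x\<rfloor>" | "nat \<lfloor>y\<rfloor> = Suc (nat \<lfloor>x\<rfloor>)"
      by linarith
    then show ?thesis
    proof cases
      case 1
      then show ?thesis
        using dyadic_bound_nonneg r by (simp add: dyadic_floor_def x_def y_def)
    next
      case 2
      have "nat \<lfloor>x\<rfloor> < 2 ^ n"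
        using dyadic_floor_index[OF t, of n, folded y_def] unfolding 2 by (rule Suc_le_lessD)
      from incr[OF this] show ?thesis
        using 2 by (simp add: dyadic_floor_def x_def y_def)
    qed
  qed
  show ?thesis
    using *[OF s t] *[OF t s] st by (cases "s \<le> t") (auto simp: abs_minus_commute)
qed

text \<open>The refinements telescope into a series dominated by the geometric series of
  \<open>B * r ^ Suc n\<close>. Naming the limit by \<open>lim\<close> makes its measurability in
  \<omega> immediate later.\<close>

lemma dyadic_uniform_limit:
  "uniform_limit {0..T} (\<lambda>n t. z (dyadic_floor T n t)) (\<lambda>t. lim (\<lambda>n. z (dyadic_floor T n t))) sequentially"
proof -
  define f where "f n t = z (dyadic_floor T (Suc n) t) - z (dyadic_floor T n t)" for n t
  have sum: "summable (\<lambda>n. B * r ^ Suc n)"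
    using r by (intro summable_mult summable_Suc_iff[THEN iffD2] summable_geometric) auto
  have "uniform_limit {0..T} (\<lambda>n t. \<Sum>i<n. f i t) (\<lambda>t. \<Sum>i. f i t) sequentially"
    by (rule Weierstrass_m_test[OF _ sum]) (simp add: f_def dyadic_refinement_bound del: power_Suc)
  then have "uniform_limit {0..T} (\<lambda>n t. z (dyadic_floor T 0 t) + (\<Sum>i<n. f i t))
      (\<lambda>t. z (dyadic_floor T 0 t) + (\<Sum>i. f i t)) sequentially"
    by (intro uniform_limit_intros)
  moreover have "z (dyadic_floor T 0 t) + (\<Sum>i<n. f i t) = z (dyadic_floor T n t)" for n t
    unfolding f_def by (subst sum_lessThan_telescope) simp
  ultimately have u: "uniform_limit {0..T} (\<lambda>n t. z (dyadic_floor T n t))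
      (\<lambda>t. z (dyadic_floor T 0 t) + (\<Sum>i. f i t)) sequentially"
    by simp
  have "z (dyadic_floor T 0 t) + (\<Sum>i. f i t) = lim (\<lambda>n. z (dyadic_floor T n t))" if "t \<in> {0..T}" for t
    using limI[OF tendsto_uniform_limitI[OF u that]] by simp
  then show ?thesis
    by (intro uniform_limit_cong'[THEN iffD1, OF _ _ u]) auto
qed

text \<open>The approximants may jump at grid points, so continuity cannot be inherited from them.
  Instead one level \<open>n\<close> is fixed at which the uniform error and the jump between
  adjacent grid points are both below \<open>e / 3\<close>.\<close>

lemma dyadic_limit_continuous: "continuous_on {0..T} (\<lambda>t. lim (\<lambda>n. z (dyadic_floor T n t)))"
proof -
  define x where "x t = lim (\<lambda>n. z (dyadic_floor T n t))" for t
  have "\<exists>d>0. \<forall>s\<in>{0..T}. dist s t < d \<longrightarrow> dist (x s) (x t) < e" if t: "t \<in> {0..T}" and e: "0 < e" for t e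
  proof -
    have "\<forall>\<^sub>F n in sequentially. \<forall>s\<in>{0..T}. dist (z (dyadic_floor T n s)) (x s) < e / 3"
      using dyadic_uniform_limit[unfolded uniform_limit_iff, rule_format, of "e / 3"] e
      unfolding x_def by (simp del: less_divide_eq_numeral1)
    moreover have "(\<lambda>n. B * r ^ n) \<longlonglongrightarrow> B * 0"
      using r by (intro tendsto_intros LIMSEQ_power_zero) auto
    then have "\<forall>\<^sub>F n in sequentially. B * r ^ n < e / 3"
      using e by (intro order_tendstoD) auto
    ultimately have "\<forall>\<^sub>F n in sequentially. (\<forall>s\<in>{0..T}. dist (z (dyadic_floor T n s)) (x s) < e / 3)
        \<and> B * r ^ n < e / 3"
      by (rule eventually_conj)
    then obtain n where n: "\<And>s. s \<in> {0..T} \<Longrightarrow> dist (z (dyadic_floor T n s)) (x s) < e / 3"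
        "B * r ^ n < e / 3"
      unfolding eventually_sequentially by blast
    have "dist (x s) (x t) < e" if s: "s \<in> {0..T}" and st: "dist s t < T / 2 ^ n" for s
      using n(1)[OF s] n(1)[OF t] n(2) dyadic_close_bound[OF t s, of n] st
      unfolding dist_real_def by linarith
    then show ?thesis using T by (intro exI[of _ "T / 2 ^ n"]) auto
  qed
  then show ?thesis unfolding continuous_on_iff x_def by blast
qed

end

lemma kolmogorov_continuity:
  fixes Z :: "real \<Rightarrow> 'a \<Rightarrow> real"
  assumes Z[measurable]: "\<And>t. t \<in> {0..T} \<Longrightarrow> Z t \<in> borel_measurable M"
    and m: "0 < m" and c: "0 \<le> c"
    and moment: "\<And>s t. 0 \<le> s \<Longrightarrow> s \<le> t \<Longrightarrow> t \<le> T \<Longrightarrow>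
      (\<integral>\<^sup>+\<omega>. ennreal ((Z t \<omega> - Z s \<omega>) ^ (2 * m)) \<partial>M) \<le> ennreal (c * (t - s) ^ 3)"
  shows "\<exists>X. continuous_modification M T Z X"
proof -
  define p where "p n i = real i * T / 2 ^ n" for n i :: nat
  have p: "p n i \<in> {0..T}" if "i \<le> 2 ^ n" for n i
  proof -
    have "real i \<le> 2 ^ n" using that by (metis of_nat_le_iff of_nat_numeral of_nat_power)
    then show ?thesis using T by (simp add: p_def field_simps)
  qed
  define S where "S \<omega> = (\<Sum>n. \<Sum>i<2^n. ennreal (2 ^ n * (Z (p n (Suc i)) \<omega> - Z (p n i) \<omega>) ^ (2 * m)))" for \<omega>
  have incr_meas: "(\<lambda>\<omega>. ennreal (2 ^ n * (Z (p n (Suc i)) \<omega> - Z (p n i) \<omega>) ^ (2 * m))) \<in> borel_measurable M"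
    if "i < 2 ^ n" for n i
  proof -
    have [measurable]: "Z (p n i) \<in> borel_measurable M" "Z (p n (Suc i)) \<in> borel_measurable M"
      using p[of i n] p[of "Suc i" n] that by auto
    show ?thesis by measurable
  qed
  have level_meas: "(\<lambda>\<omega>. \<Sum>i<2^n. ennreal (2 ^ n * (Z (p n (Suc i)) \<omega> - Z (p n i) \<omega>) ^ (2 * m))) \<in> borel_measurable M" for n
    using incr_meas by (intro borel_measurable_sum) auto
  have S_meas[measurable]: "S \<in> borel_measurable M"
    unfolding S_def using level_meas by (intro borel_measurable_suminf_order) auto
  have "(\<integral>\<^sup>+\<omega>. S \<omega> \<partial>M) = (\<Sum>n. \<integral>\<^sup>+\<omega>. (\<Sum>i<2^n. ennreal (2 ^ n * (Z (p n (Suc i)) \<omega> - Z (p n i) \<omega>) ^ (2 * m))) \<partial>M)"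
    unfolding S_def using level_meas by (rule nn_integral_suminf)
  also have "\<dots> \<le> (\<Sum>n. ennreal (c * T ^ 3 * (1 / 2) ^ n))"
  proof (rule suminf_le)
    fix n
    have "(\<integral>\<^sup>+\<omega>. (\<Sum>i<2^n. ennreal (2 ^ n * (Z (p n (Suc i)) \<omega> - Z (p n i) \<omega>) ^ (2 * m))) \<partial>M)
        = (\<Sum>i<2^n. \<integral>\<^sup>+\<omega>. ennreal (2 ^ n * (Z (p n (Suc i)) \<omega> - Z (p n i) \<omega>) ^ (2 * m)) \<partial>M)"
      using incr_meas by (intro nn_integral_sum) auto
    also have "\<dots> \<le> (\<Sum>i<(2::nat)^n. ennreal (2 ^ n * (c * (T / 2 ^ n) ^ 3)))"
    proof (rule sum_mono)
      fix i :: nat assume "i \<in> {..<2 ^ n}"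
      then have i: "i < 2 ^ n" by simp
      have [measurable]: "Z (p n i) \<in> borel_measurable M" "Z (p n (Suc i)) \<in> borel_measurable M"
        using p[of i n] p[of "Suc i" n] i by auto
      have d: "p n (Suc i) - p n i = T / 2 ^ n" by (simp add: p_def field_simps)
      have "(\<integral>\<^sup>+\<omega>. ennreal (2 ^ n * (Z (p n (Suc i)) \<omega> - Z (p n i) \<omega>) ^ (2 * m)) \<partial>M)
          = ennreal (2 ^ n) * (\<integral>\<^sup>+\<omega>. ennreal ((Z (p n (Suc i)) \<omega> - Z (p n i) \<omega>) ^ (2 * m)) \<partial>M)"
        by (subst nn_integral_cmult[symmetric]) (auto simp: ennreal_mult')
      also have "\<dots> \<le> ennreal (2 ^ n) * ennreal (c * (T / 2 ^ n) ^ 3)"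
        unfolding d[symmetric]
        using p[of i n] p[of "Suc i" n] i T d
        by (intro mult_left_mono moment) (auto simp: p_def divide_right_mono)
      finally show "(\<integral>\<^sup>+\<omega>. ennreal (2 ^ n * (Z (p n (Suc i)) \<omega> - Z (p n i) \<omega>) ^ (2 * m)) \<partial>M)
          \<le> ennreal (2 ^ n * (c * (T / 2 ^ n) ^ 3))"
        by (simp add: ennreal_mult')
    qed
    also have "\<dots> = ennreal (2 ^ n * (2 ^ n * (c * (T / 2 ^ n) ^ 3)))"
      by (simp add: ennreal_mult' flip: ennreal_power)
    also have "2 ^ n * (2 ^ n * (c * (T / 2 ^ n) ^ 3)) = c * T ^ 3 * (1 / 2) ^ n"
      by (simp add: power_divide power3_eq_cube field_simps)
    finally show "(\<integral>\<^sup>+\<omega>. (\<Sum>i<2^n. ennreal (2 ^ n * (Z (p n (Suc i)) \<omega> - Z (p n i) \<omega>) ^ (2 * m))) \<partial>M)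
        \<le> ennreal (c * T ^ 3 * (1 / 2) ^ n)" .
  qed auto
  also have "\<dots> = ennreal (\<Sum>n. c * T ^ 3 * (1 / 2) ^ n)"
    using c T by (intro suminf_ennreal2) (auto intro!: summable_mult summable_geometric)
  finally have "(\<integral>\<^sup>+\<omega>. S \<omega> \<partial>M) \<noteq> \<infinity>" by (auto simp: top_unique)
  then have S_fin: "AE \<omega> in M. S \<omega> \<noteq> \<infinity>"
    by (intro nn_integral_PInf_AE S_meas)
  define good where "good = {\<omega> \<in> space M. S \<omega> \<noteq> \<infinity>}"
  have [measurable]: "good \<in> sets M" unfolding good_def by measurable
  \<comment> \<open>Each weighted summand is at most \<open>S \<omega>\<close>, so the increment to
    the power \<open>2 * m\<close> is at most \<open>S \<omega> / 2 ^ n\<close>; the root of order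
    \<open>2 * m\<close> gives the ratio \<open>r\<close>.\<close>
  define r where "r = root (2 * m) (1 / 2)"
  have r: "0 \<le> r" "r < 1" using m by (auto simp: r_def)
  have incr: "\<exists>B. \<forall>n i. i < 2 ^ n \<longrightarrow> \<bar>Z (real (Suc i) * T / 2 ^ n) \<omega> - Z (real i * T / 2 ^ n) \<omega>\<bar> \<le> B * r ^ n"
    if "\<omega> \<in> good" for \<omega>
  proof (intro exI allI impI)
    fix n i :: nat assume i: "i < 2 ^ n"
    define b where "b = enn2real (S \<omega>)"
    define d where "d = \<bar>Z (p n (Suc i)) \<omega> - Z (p n i) \<omega>\<bar>"
    have b: "S \<omega> = ennreal b" "0 \<le> b"
      using that by (auto simp: b_def good_def less_top)
    have "ennreal (2 ^ n * (Z (p n (Suc i)) \<omega> - Z (p n i) \<omega>) ^ (2 * m))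
        \<le> (\<Sum>i<2^n. ennreal (2 ^ n * (Z (p n (Suc i)) \<omega> - Z (p n i) \<omega>) ^ (2 * m)))"
      by (rule sum_nonneg_leq_bound[OF _ _ refl]) (use i in auto)
    also have "\<dots> \<le> S \<omega>"
      unfolding S_def
      using sum_le_suminf[OF summableI, of "{n}" "\<lambda>n. \<Sum>i<2^n. ennreal (2 ^ n * (Z (p n (Suc i)) \<omega> - Z (p n i) \<omega>) ^ (2 * m))"]
      by simp
    finally have "2 ^ n * (Z (p n (Suc i)) \<omega> - Z (p n i) \<omega>) ^ (2 * m) \<le> b"
      unfolding b(1) using b(2) by simp
    then have "d ^ (2 * m) \<le> b * (1 / 2) ^ n"
      by (simp add: d_def power_even_abs field_simps)
    then have "root (2 * m) (d ^ (2 * m)) \<le> root (2 * m) (b * (1 / 2) ^ n)"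
      using m by simp
    moreover have "root (2 * m) (d ^ (2 * m)) = d"
      using m by (intro real_root_power_cancel) (auto simp: d_def)
    ultimately show "\<bar>Z (real (Suc i) * T / 2 ^ n) \<omega> - Z (real i * T / 2 ^ n) \<omega>\<bar>
        \<le> root (2 * m) (enn2real (S \<omega>)) * r ^ n"
      using m by (simp add: d_def p_def b_def r_def real_root_mult real_root_power)
  qed
  \<comment> \<open>The exceptional null set gets the zero path, since every path of a
    \<open>continuous_modification\<close> has to be continuous.\<close>
  define X where "X t \<omega> = (if \<omega> \<in> good then lim (\<lambda>n. Z (dyadic_floor T n t) \<omega>) else 0)" for t \<omega>
  have X_meas: "X t \<in> borel_measurable M" if "t \<in> {0..T}" for t
  proof -
    have [measurable]: "Z (dyadic_floor T n t) \<in> borel_measurable M" for n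
      using dyadic_floor_bounds(1)[OF that] by (rule Z)
    show ?thesis unfolding X_def[abs_def] by measurable
  qed
  have X_cont: "continuous_on {0..T} (\<lambda>t. X t \<omega>)" for \<omega>
  proof (cases "\<omega> \<in> good")
    case True
    from incr[OF this] obtain B where
      "\<forall>n i. i < 2 ^ n \<longrightarrow> \<bar>Z (real (Suc i) * T / 2 ^ n) \<omega> - Z (real i * T / 2 ^ n) \<omega>\<bar> \<le> B * r ^ n" ..
    from dyadic_limit_continuous[OF r this[rule_format]] True show ?thesis by (simp add: X_def)
  qed (simp add: X_def)
  have X_lim: "(\<lambda>n. Z (dyadic_floor T n t) \<omega>) \<longlonglongrightarrow> X t \<omega>" if "\<omega> \<in> good" "t \<in> {0..T}" for \<omega> t
  proof -
    from incr[OF that(1)] obtain B where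
      "\<forall>n i. i < 2 ^ n \<longrightarrow> \<bar>Z (real (Suc i) * T / 2 ^ n) \<omega> - Z (real i * T / 2 ^ n) \<omega>\<bar> \<le> B * r ^ n" ..
    from tendsto_uniform_limitI[OF dyadic_uniform_limit[OF r this[rule_format]] that(2)] that(1)
    show ?thesis by (simp add: X_def)
  qed
  have "AE \<omega> in M. X t \<omega> = Z t \<omega>" if t: "t \<in> {0..T}" for t
  proof -
    note fl = dyadic_floor_bounds[OF t]
    have [measurable]: "Z (dyadic_floor T n t) \<in> borel_measurable M" for n
      using fl(1) by (rule Z)
    note [measurable] = Z[OF t] X_meas[OF t]
    \<comment> \<open>Fatou at a fixed \<open>t\<close>: the grid points tend to \<open>t\<close>,
      so the moments of \<open>Z t - Z (dyadic_floor T n t)\<close> tend to 0, while the variables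
      tend to \<open>Z t - X t\<close> almost surely.\<close>
    have "(\<integral>\<^sup>+\<omega>. ennreal ((Z t \<omega> - X t \<omega>) ^ (2 * m)) \<partial>M)
        = (\<integral>\<^sup>+\<omega>. liminf (\<lambda>n. ennreal ((Z t \<omega> - Z (dyadic_floor T n t) \<omega>) ^ (2 * m))) \<partial>M)"
    proof (rule nn_integral_cong_AE)
      show "AE \<omega> in M. ennreal ((Z t \<omega> - X t \<omega>) ^ (2 * m)) =
          liminf (\<lambda>n. ennreal ((Z t \<omega> - Z (dyadic_floor T n t) \<omega>) ^ (2 * m)))"
        using S_fin AE_space
      proof eventually_elim
        case (elim \<omega>)
        then have "\<omega> \<in> good" by (simp add: good_def)
        from X_lim[OF this t]
        have "(\<lambda>n. ennreal ((Z t \<omega> - Z (dyadic_floor T n t) \<omega>) ^ (2 * m)))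
            \<longlonglongrightarrow> ennreal ((Z t \<omega> - X t \<omega>) ^ (2 * m))"
          by (intro tendsto_intros)
        then show ?case by (intro lim_imp_Liminf[symmetric]) auto
      qed
    qed
    also have "\<dots> \<le> liminf (\<lambda>n. \<integral>\<^sup>+\<omega>. ennreal ((Z t \<omega> - Z (dyadic_floor T n t) \<omega>) ^ (2 * m)) \<partial>M)"
      by (rule nn_integral_liminf) simp
    also have "\<dots> \<le> liminf (\<lambda>n. ennreal (c * (T / 2 ^ n) ^ 3))"
    proof (intro Liminf_mono always_eventually allI)
      fix n
      have "(\<integral>\<^sup>+\<omega>. ennreal ((Z t \<omega> - Z (dyadic_floor T n t) \<omega>) ^ (2 * m)) \<partial>M)
          \<le> ennreal (c * (t - dyadic_floor T n t) ^ 3)"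
        using fl(1,2)[of n] t by (intro moment) auto
      also have "\<dots> \<le> ennreal (c * (T / 2 ^ n) ^ 3)"
        using fl(2,3)[of n] c by (intro ennreal_leI mult_left_mono power_mono) auto
      finally show "(\<integral>\<^sup>+\<omega>. ennreal ((Z t \<omega> - Z (dyadic_floor T n t) \<omega>) ^ (2 * m)) \<partial>M)
          \<le> ennreal (c * (T / 2 ^ n) ^ 3)" .
    qed
    also have "\<dots> = ennreal (c * (T * 0) ^ 3)"
    proof (rule lim_imp_Liminf)
      have "(\<lambda>n. ennreal (c * (T * (1 / 2) ^ n) ^ 3)) \<longlonglongrightarrow> ennreal (c * (T * 0) ^ 3)"
        by (intro tendsto_intros LIMSEQ_power_zero) auto
      then show "(\<lambda>n. ennreal (c * (T / 2 ^ n) ^ 3)) \<longlonglongrightarrow> ennreal (c * (T * 0) ^ 3)"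
        by (simp add: power_one_over)
    qed simp
    finally have "(\<integral>\<^sup>+\<omega>. ennreal ((Z t \<omega> - X t \<omega>) ^ (2 * m)) \<partial>M) = 0" by simp
    then have "AE \<omega> in M. ennreal ((Z t \<omega> - X t \<omega>) ^ (2 * m)) = 0"
      by (subst (asm) nn_integral_0_iff_AE) auto
    then show ?thesis
    proof eventually_elim
      case (elim \<omega>)
      then have "(Z t \<omega> - X t \<omega>) ^ (2 * m) \<le> 0" by (simp add: ennreal_eq_0_iff)
      moreover have "0 \<le> (Z t \<omega> - X t \<omega>) ^ (2 * m)" by simp
      ultimately have "(Z t \<omega> - X t \<omega>) ^ (2 * m) = 0" by linarith
      then show ?case using m by simp
    qed
  qed
  then show ?thesis
    using X_meas X_cont
    unfolding continuous_modification_def continuous_process_on_def process_on_def by blast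
qed

end


section \<open>The deterministic equations\<close>

context
  fixes x :: "real \<Rightarrow> real" and \<alpha> T :: real and u :: "real \<Rightarrow> real"
  assumes x: "continuous_on {0..T} x" and T: "0 < T"
  defines "u \<equiv> \<lambda>t. exp (\<alpha> * t) * (LBINT s:{0..t}. exp (- \<alpha> * s) * x s)"
begin

lemma duhamel_zero: "u 0 = 0"
proof -
  have "AE s in lborel. indicator {0} s *\<^sub>R (exp (- \<alpha> * s) * x s) = (0 :: real)"
    using AE_lborel_singleton[of 0] by eventually_elim simp
  then have "(LBINT s:{0..0}. exp (- \<alpha> * s) * x s) = 0"
    unfolding set_lebesgue_integral_def by (intro integral_eq_zero_AE) simp
  then show ?thesis by (simp add: u_def)
qed

text \<open>The Lebesgue integral is replaced by the gauge integral \<open>integral\<close>, to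
  which the fundamental theorem is applied; the two are shown to agree for upper limits in
  \<open>{0..T}\<close>, hence the transfer within that set.\<close>

lemma duhamel_has_derivative:
  assumes "t \<in> {0..T}"
  shows "(u has_real_derivative \<alpha> * u t + x t) (at t within {0..T})"
proof -
  define I where "I t = integral {0..t} (\<lambda>s. exp (- \<alpha> * s) * x s)" for t
  have cont: "continuous_on {0..T} (\<lambda>s. exp (- \<alpha> * s) * x s)"
    using x by (intro continuous_intros)
  have I: "(LBINT s:{0..t}. exp (- \<alpha> * s) * x s) = I t" if "t \<in> {0..T}" for t
    unfolding I_def
    using that by (intro set_borel_integral_eq_integral borel_integrable_atLeastAtMost'
        continuous_on_subset[OF cont]) auto
  have "(I has_real_derivative exp (- \<alpha> * t) * x t) (at t within {0..T})"
    unfolding I_def using cont assms by (rule integral_has_real_derivative)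
  then have "((\<lambda>t. exp (\<alpha> * t) * I t) has_real_derivative
      (\<alpha> * exp (\<alpha> * t)) * I t + (exp (- \<alpha> * t) * x t) * exp (\<alpha> * t)) (at t within {0..T})"
    by (intro DERIV_mult) (auto intro!: derivative_eq_intros)
  moreover have "(\<alpha> * exp (\<alpha> * t)) * I t + (exp (- \<alpha> * t) * x t) * exp (\<alpha> * t) = \<alpha> * u t + x t"
    using I[OF assms] by (simp add: u_def exp_minus field_simps)
  ultimately have "((\<lambda>t. exp (\<alpha> * t) * I t) has_real_derivative \<alpha> * u t + x t) (at t within {0..T})"
    by simp
  then show ?thesis
    by (rule has_field_derivative_transform_within[where d = 1]) (use assms I in \<open>auto simp: u_def\<close>)
qed

text \<open>The difference of two solutions solves the homogeneous equation, so its product with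
  \<open>exp (- \<alpha> * r)\<close> has derivative zero.\<close>

lemma duhamel_unique:
  assumes v0: "v 0 = 0"
    and v: "\<And>t. t \<in> {0..T} \<Longrightarrow> (v has_real_derivative \<alpha> * v t + x t) (at t within {0..T})"
    and t: "t \<in> {0..T}"
  shows "v t = u t"
proof -
  define w where "w r = exp (- \<alpha> * r) * (v r - u r)" for r
  have "(w has_real_derivative 0) (at r within {0..T})" if "r \<in> {0..T}" for r
  proof -
    have "((\<lambda>r. v r - u r) has_real_derivative \<alpha> * (v r - u r)) (at r within {0..T})"
      using DERIV_diff[OF v duhamel_has_derivative, OF that that] by (simp add: algebra_simps)
    moreover have "((\<lambda>r. exp (- \<alpha> * r)) has_real_derivative - \<alpha> * exp (- \<alpha> * r)) (at r within {0..T})"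
      by (auto intro!: derivative_eq_intros)
    ultimately show ?thesis
      unfolding w_def[abs_def]
      by (intro DERIV_cong[OF DERIV_mult]) (auto simp: algebra_simps)
  qed
  then have "\<exists>c. \<forall>r\<in>{0..T}. w r = c"
    by (intro has_field_derivative_zero_constant) auto
  then obtain c where "\<And>r. r \<in> {0..T} \<Longrightarrow> w r = c" by blast
  from this[of 0] this[of t] have "w t = w 0"
    using t T by simp
  then show ?thesis using duhamel_zero v0 by (simp add: w_def)
qed

lemma duhamel_continuous: "continuous_on {0..T} u"
  by (rule DERIV_continuous_on) (rule duhamel_has_derivative)

lemma langevin_solution_continuous: "continuous_on {0..T} (\<lambda>t. \<alpha> * u t + x t)"
  using duhamel_continuous x by (intro continuous_intros)

text \<open>The integrand is the derivative of \<open>u\<close>, and \<open>u 0 = 0\<close>.\<close>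

lemma set_lebesgue_integral_langevin_solution:
  assumes t: "t \<in> {0..T}"
  shows "(LINT s:{0..t}|lebesgue. \<alpha> * u s + x s) = u t"
proof -
  have "set_integrable lborel {0..t} (\<lambda>s. \<alpha> * u s + x s)"
    using t by (intro borel_integrable_atLeastAtMost'
        continuous_on_subset[OF langevin_solution_continuous]) auto
  then have "set_integrable lebesgue {0..t} (\<lambda>s. \<alpha> * u s + x s)"
    by (simp add: set_integrable_def integrable_completion)
  then have "(LINT s:{0..t}|lebesgue. \<alpha> * u s + x s) = integral {0..t} (\<lambda>s. \<alpha> * u s + x s)"
    by (rule set_lebesgue_integral_eq_integral)
  also have "((\<lambda>s. \<alpha> * u s + x s) has_integral u t - u 0) {0..t}"
    using t by (intro fundamental_theorem_of_calculus)
      (auto intro!: has_vector_derivative_within_subset[OF duhamel_has_derivative[THEN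
          has_real_derivative_iff_has_vector_derivative[THEN iffD1]]])
  then have "integral {0..t} (\<lambda>s. \<alpha> * u s + x s) = u t"
    by (simp add: duhamel_zero integral_unique)
  finally show ?thesis .
qed

text \<open>
  A Langevin solution is continuous because its indefinite integral is, so the integral solves the
  linear equation.
\<close>

lemma langevin_unique:
  assumes int: "set_integrable lebesgue {0..T} v"
    and v: "\<And>t. t \<in> {0..T} \<Longrightarrow> v t = \<alpha> * (LINT s:{0..t}|lebesgue. v s) + x t"
    and t: "t \<in> {0..T}"
  shows "v t = \<alpha> * u t + x t"
proof -
  define P where "P t = integral {0..t} v" for t
  have sub: "set_integrable lebesgue {0..t} v" if "t \<in> {0..T}" for t
    using int that by (intro set_integrable_subset[OF int]) auto
  have P: "(LINT s:{0..t}|lebesgue. v s) = P t" if "t \<in> {0..T}" for t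
    unfolding P_def using sub[OF that] by (rule set_lebesgue_integral_eq_integral)
  have "v integrable_on {0..T}"
    using int by (rule set_lebesgue_integral_eq_integral)
  then have "continuous_on {0..T} P"
    unfolding P_def by (rule indefinite_integral_continuous_1)
  then have "continuous_on {0..T} (\<lambda>t. \<alpha> * P t + x t)"
    using x by (intro continuous_intros)
  then have cont: "continuous_on {0..T} v"
    by (rule continuous_on_eq) (simp add: v P)
  have "(P has_real_derivative \<alpha> * P r + x r) (at r within {0..T})" if "r \<in> {0..T}" for r
    using integral_has_real_derivative[OF cont that] v[OF that] P[OF that] by (simp add: P_def[abs_def])
  moreover have "P 0 = 0" by (simp add: P_def)
  ultimately have "P t = u t" using t by (intro duhamel_unique) auto
  then show ?thesis using v[OF t] P[OF t] by simp
qed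

end


section \<open>Volterra processes with mean-square bounded increments\<close>

text \<open>A \<open>volterra_kernel\<close> is controlled on the triangle only; extended by zero it
  is jointly Borel on the plane, and its sections become integrands on the whole line.\<close>

definition triangle_kernel :: "real \<Rightarrow> (real \<Rightarrow> real \<Rightarrow> real) \<Rightarrow> real \<Rightarrow> real \<Rightarrow> real" where
  "triangle_kernel T K s u = (if 0 \<le> u \<and> u \<le> s \<and> s \<le> T then K s u else 0)"

lemma triangle_kernel_measurable:
  assumes "volterra_kernel T K"
  shows "(\<lambda>(s, u). triangle_kernel T K s u) \<in> borel_measurable (lborel \<Otimes>\<^sub>M lborel)"
proof -
  have eq: "(\<lambda>(s, u). triangle_kernel T K s u)
      = (\<lambda>z. indicator {(t, s). 0 \<le> s \<and> s \<le> t \<and> t \<le> T} z *\<^sub>R (case z of (s, u) \<Rightarrow> K s u))"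
    by (auto simp: triangle_kernel_def fun_eq_iff)
  have "(\<lambda>(s, u). triangle_kernel T K s u) \<in> borel_measurable borel"
    unfolding eq using assms by (simp add: volterra_kernel_def set_borel_measurable_def)
  then show ?thesis
    by (simp add: borel_prod[symmetric] cong: measurable_cong_sets)
qed

text \<open>Links the closed intervals of the statement with the half-open ones of step functions.
  The integrands differ at most at \<open>a\<close>, so either both are integrable or both integrals
  take the default 0, and \<open>f\<close> may be arbitrary.\<close>

lemma integral_indicator_half_open:
  fixes f :: "real \<Rightarrow> real"
  shows "(LINT s|lborel. indicator {a..b} s * f s) = (LINT s|lborel. indicator {a<..b} s * f s)"
proof -
  define g h where "g s = indicator {a<..b} s * f s" and "h s = (if a \<le> b then f a else 0) * indicator {a} s" for s
  have eq: "(\<lambda>s. indicator {a..b} s * f s) = (\<lambda>s. g s + h s)"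
    by (auto simp: g_def h_def indicator_def fun_eq_iff)
  have h: "integrable lborel h" "integral\<^sup>L lborel h = 0"
    unfolding h_def by (auto simp: integrable_indicator_iff)
  have "integrable lborel (\<lambda>s. g s + h s) \<longleftrightarrow> integrable lborel g"
    using h(1) Bochner_Integration.integrable_diff[of lborel "\<lambda>s. g s + h s" h] by auto
  then have "(LINT s|lborel. g s + h s) = integral\<^sup>L lborel g"
    using h by (cases "integrable lborel g") (auto simp: not_integrable_integral_eq)
  then show ?thesis by (simp add: eq g_def[abs_def])
qed

text \<open>Splits the difference into \<open>a s * (X s - X s')\<close> and
  \<open>(a s - a s') * X s'\<close>: the first is small by the increment bound, the second by
  uniform continuity of \<open>a\<close> and the bounded second moments. Each gets
  \<open>e / 4\<close>, since the squared triangle inequality doubles both.\<close>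

lemma weighted_mean_square_continuous:
  fixes X :: "real \<Rightarrow> 'a \<Rightarrow> real"
  assumes a: "continuous_on {0..t} a" and C: "0 < C" and \<delta>: "0 < \<delta>"
    and [measurable]: "\<And>s. X s \<in> borel_measurable M"
    and X2: "\<And>s. s \<in> {0..t} \<Longrightarrow> integrable M (\<lambda>\<omega>. (X s \<omega>)\<^sup>2)"
    and B: "\<And>s. s \<in> {0..t} \<Longrightarrow> (LINT \<omega>|M. (X s \<omega>)\<^sup>2) \<le> B"
    and incr: "\<And>s s'. s \<in> {0..t} \<Longrightarrow> s' \<in> {0..t} \<Longrightarrow>
      (LINT \<omega>|M. (X s \<omega> - X s' \<omega>)\<^sup>2) \<le> C * \<bar>s - s'\<bar> powr \<delta>"
    and e: "0 < e"
  shows "\<exists>h>0. \<forall>s\<in>{0..t}. \<forall>s'\<in>{0..t}. \<bar>s - s'\<bar> \<le> h \<longrightarrow>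
      (\<integral>\<^sup>+\<omega>. ennreal ((a s * X s \<omega> - a s' * X s' \<omega>)\<^sup>2) \<partial>M) \<le> ennreal e"
proof -
  obtain A where A: "0 < A" "\<And>s. s \<in> {0..t} \<Longrightarrow> \<bar>a s\<bar> \<le> A"
  proof -
    have "bounded (a ` {0..t})"
      using a by (intro compact_imp_bounded compact_continuous_image) auto
    then obtain A where "0 < A" "\<forall>y\<in>a ` {0..t}. norm y \<le> A"
      unfolding bounded_pos by blast
    with that show ?thesis by auto
  qed
  \<comment> \<open>The solution of
    \<open>A\<^sup>2 * (C * h1 powr \<delta>) = e / 4\<close>.\<close>
  define h1 where "h1 = (e / (4 * A\<^sup>2 * C)) powr (1 / \<delta>)"
  have h1: "0 < h1" "C * h1 powr \<delta> = e / (4 * A\<^sup>2)"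
    using e A(1) C \<delta> by (auto simp: h1_def powr_powr)
  \<comment> \<open>\<open>\<bar>B\<bar> + 1\<close> is positive and at least \<open>B\<close>,
    whatever the sign of \<open>B\<close>.\<close>
  define \<eta> where "\<eta> = sqrt (e / (4 * (\<bar>B\<bar> + 1)))"
  have \<eta>: "0 < \<eta>" "\<eta>\<^sup>2 = e / (4 * (\<bar>B\<bar> + 1))"
    using e by (auto simp: \<eta>_def add_nonneg_pos)
  have "uniformly_continuous_on {0..t} a"
    using a by (intro compact_uniformly_continuous) auto
  then obtain h2 where h2: "0 < h2"
    "\<And>s s'. s \<in> {0..t} \<Longrightarrow> s' \<in> {0..t} \<Longrightarrow> dist s' s < h2 \<Longrightarrow> dist (a s') (a s) < \<eta>"
    unfolding uniformly_continuous_on_def using \<eta>(1) by metis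
  \<comment> \<open>Halving \<open>h2\<close> turns the non-strict condition on the distance into
    the strict one of uniform continuity.\<close>
  define h where "h = min h1 (h2 / 2)"
  have "(\<integral>\<^sup>+\<omega>. ennreal ((a s * X s \<omega> - a s' * X s' \<omega>)\<^sup>2) \<partial>M) \<le> ennreal e"
    if s: "s \<in> {0..t}" and s': "s' \<in> {0..t}" and hs: "\<bar>s - s'\<bar> \<le> h" for s s'
  proof -
    have i1: "integrable M (\<lambda>\<omega>. (X s \<omega> - X s' \<omega>)\<^sup>2)"
      using X2[OF s] X2[OF s'] by (intro integrable_square_diff) auto
    have "\<bar>a s'  - a s\<bar> \<le> \<eta>"
      using h2(2)[OF s s'] hs h2(1) unfolding h_def dist_real_def by linarith
    then have "(a s - a s')\<^sup>2 \<le> \<eta>\<^sup>2"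
      using \<eta>(1) by (intro power2_le_iff_abs_le[THEN iffD2]) auto
    then have two: "(a s - a s')\<^sup>2 * (LINT \<omega>|M. (X s' \<omega>)\<^sup>2) \<le> e / 4"
    proof -
      have "(a s - a s')\<^sup>2 * (LINT \<omega>|M. (X s' \<omega>)\<^sup>2) \<le> \<eta>\<^sup>2 * (\<bar>B\<bar> + 1)"
        using \<open>(a s - a s')\<^sup>2 \<le> \<eta>\<^sup>2\<close> B[OF s'] by (intro mult_mono) auto
      also have "\<dots> = e / 4" unfolding \<eta>(2) by (simp add: field_simps)
      finally show ?thesis .
    qed
    have one: "(a s)\<^sup>2 * (LINT \<omega>|M. (X s \<omega> - X s' \<omega>)\<^sup>2) \<le> e / 4"
    proof -
      have "(LINT \<omega>|M. (X s \<omega> - X s' \<omega>)\<^sup>2) \<le> C * h1 powr \<delta>"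
        using incr[OF s s'] hs C \<delta>
        by (elim order_trans) (auto intro!: mult_left_mono powr_mono2 simp: h_def)
      moreover have "(a s)\<^sup>2 \<le> A\<^sup>2"
        using A(2)[OF s] A(1) by (intro power2_le_iff_abs_le[THEN iffD2]) auto
      ultimately have "(a s)\<^sup>2 * (LINT \<omega>|M. (X s \<omega> - X s' \<omega>)\<^sup>2) \<le> A\<^sup>2 * (C * h1 powr \<delta>)"
        by (intro mult_mono) auto
      also have "\<dots> = e / 4" unfolding h1(2) using A(1) by simp
      finally show ?thesis .
    qed
    have "(\<integral>\<^sup>+\<omega>. ennreal ((a s * X s \<omega> - a s' * X s' \<omega>)\<^sup>2) \<partial>M)
      \<le> 2 * (\<integral>\<^sup>+\<omega>. ennreal ((a s * X s \<omega> - a s * X s' \<omega>)\<^sup>2) \<partial>M)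
        + 2 * (\<integral>\<^sup>+\<omega>. ennreal ((a s * X s' \<omega> - a s' * X s' \<omega>)\<^sup>2) \<partial>M)"
      by (rule nn_integral_square_diff_le) measurable
    also have "(\<integral>\<^sup>+\<omega>. ennreal ((a s * X s \<omega> - a s * X s' \<omega>)\<^sup>2) \<partial>M)
        = ennreal ((a s)\<^sup>2 * (LINT \<omega>|M. (X s \<omega> - X s' \<omega>)\<^sup>2))"
      using i1 by (simp add: nn_integral_square_scale nn_integral_eq_integral ennreal_mult')
    also have "(\<integral>\<^sup>+\<omega>. ennreal ((a s * X s' \<omega> - a s' * X s' \<omega>)\<^sup>2) \<partial>M)
        = ennreal ((a s - a s')\<^sup>2 * (LINT \<omega>|M. (X s' \<omega>)\<^sup>2))"
      using X2[OF s']
      by (simp add: left_diff_distrib[symmetric] power_mult_distrib nn_integral_eq_integral)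
    also have "2 * ennreal ((a s)\<^sup>2 * (LINT \<omega>|M. (X s \<omega> - X s' \<omega>)\<^sup>2))
        + 2 * ennreal ((a s - a s')\<^sup>2 * (LINT \<omega>|M. (X s' \<omega>)\<^sup>2))
        = ennreal (2 * ((a s)\<^sup>2 * (LINT \<omega>|M. (X s \<omega> - X s' \<omega>)\<^sup>2))
          + 2 * ((a s - a s')\<^sup>2 * (LINT \<omega>|M. (X s' \<omega>)\<^sup>2)))"
      by (simp add: ennreal_plus ennreal_mult' del: ennreal_plus[symmetric])
    also have "\<dots> \<le> ennreal e"
      using one two by (intro ennreal_leI) linarith
    finally show ?thesis .
  qed
  then show ?thesis
    using h1(1) h2(1) by (intro exI[of _ h]) (auto simp: h_def)
qed

context
  fixes M :: "'a measure" and W Z :: "real \<Rightarrow> 'a \<Rightarrow> real" and K :: "real \<Rightarrow> real \<Rightarrow> real"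
    and T C \<delta> :: real
  assumes W: "wiener_process M W" and T: "0 < T"
    and V: "gaussian_volterra_process M W T K Z"
    and C: "0 < C" and \<delta>: "0 < \<delta>"
    and incr: "\<And>s t. 0 \<le> s \<Longrightarrow> s \<le> t \<Longrightarrow> t \<le> T \<Longrightarrow>
      (LINT \<omega>|M. (Z t \<omega> - Z s \<omega>)\<^sup>2) \<le> C * \<bar>t - s\<bar> powr \<delta>"
begin

section \<open>Moments of the Volterra process and its continuous modification\<close>

lemma volterra_wiener_limit:
  assumes s: "s \<in> {0..T}"
  shows "wiener_limit M W s (triangle_kernel T K s) (Z s)"
proof -
  have "triangle_kernel T K s = (\<lambda>u. indicator {0..s} u * K s u)"
    using s by (auto simp: triangle_kernel_def fun_eq_iff)
  moreover have "has_wiener_integral M W s (K s) (Z s)"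
    using V s by (simp add: gaussian_volterra_process_def)
  ultimately show ?thesis
    using has_wiener_integral_iff_wiener_limit[OF W, of s "K s" "Z s"] s by simp
qed

lemma volterra_measurable: "s \<in> {0..T} \<Longrightarrow> Z s \<in> borel_measurable M"
  using volterra_wiener_limit wiener_limit_measurable(2) by blast

lemma volterra_square_integrable:
  assumes "s \<in> {0..T}" shows "integrable M (\<lambda>\<omega>. (Z s \<omega>)\<^sup>2)"
  using wiener_limit_square_integrable(2)[OF W volterra_wiener_limit[OF assms]] assms by simp

lemma increment_bound:
  assumes "s \<in> {0..T}" "t \<in> {0..T}"
  shows "(LINT \<omega>|M. (Z s \<omega> - Z t \<omega>)\<^sup>2) \<le> C * \<bar>s - t\<bar> powr \<delta>"
  using incr[of s t] incr[of t s] assms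
  by (cases "s \<le> t") (auto simp: abs_minus_commute power2_commute)

text \<open>At time 0 the integrand lives on a single point, so \<open>Z 0\<close> vanishes almost
  surely and \<open>Z s\<close> is the increment from 0.\<close>

lemma volterra_second_moment:
  assumes s: "s \<in> {0..T}"
  shows "(LINT \<omega>|M. (Z s \<omega>)\<^sup>2) \<le> C * T powr \<delta>"
proof -
  have T0: "0 \<in> {0..T}" using T by simp
  have "AE u in lborel. (triangle_kernel T K 0 u)\<^sup>2 = 0"
    using AE_lborel_singleton[of 0] by eventually_elim (auto simp: triangle_kernel_def)
  then have "(LINT u|lborel. (triangle_kernel T K 0 u)\<^sup>2) = 0"
    by (rule integral_eq_zero_AE)
  then have "(LINT \<omega>|M. (Z 0 \<omega>)\<^sup>2) = 0"
    using wiener_limit_isometry[OF W volterra_wiener_limit[OF T0]] by simp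
  then have "AE \<omega> in M. (Z 0 \<omega>)\<^sup>2 = 0"
    using integral_nonneg_eq_0_iff_AE[OF volterra_square_integrable[OF T0]] by simp
  then have "(LINT \<omega>|M. (Z s \<omega>)\<^sup>2) = (LINT \<omega>|M. (Z s \<omega> - Z 0 \<omega>)\<^sup>2)"
    using volterra_measurable[OF s] volterra_measurable[OF T0]
    by (intro integral_cong_AE) (auto elim!: eventually_mono)
  also have "\<dots> \<le> C * \<bar>s - 0\<bar> powr \<delta>"
    using s T0 by (rule increment_bound)
  also have "\<dots> \<le> C * T powr \<delta>"
    using s C \<delta> by (intro mult_left_mono powr_mono2) auto
  finally show ?thesis .
qed

lemma continuous_modification_exists: "\<exists>X. continuous_modification M T Z X"
proof -
  define m where "m = nat \<lceil>3 / \<delta>\<rceil> + 1"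
  have "3 / \<delta> \<le> real m" unfolding m_def by linarith
  then have m: "0 < m" "3 \<le> \<delta> * real m" using \<delta> by (auto simp: m_def field_simps)
  \<comment> \<open>Comes from \<open>h powr (\<delta> * m) \<le> T powr (\<delta> * m - 3) * h ^
    3\<close> for \<open>h \<le> T\<close>, by splitting off three powers of
    \<open>h\<close>.\<close>
  define c where "c = gaussian_moment m * C ^ m * T powr (\<delta> * real m - 3)"
  show ?thesis
  proof (rule kolmogorov_continuity[where m = m and c = c, OF T volterra_measurable m(1)])
    show "0 \<le> c" using C gaussian_moment_pos[of m] by (simp add: c_def)
    fix s t :: real assume st: "0 \<le> s" "s \<le> t" "t \<le> T"
    define h where "h = t - s"
    have h: "0 \<le> h" "h \<le> T" using st by (auto simp: h_def)
    \<comment> \<open>Both integrals are viewed up to time \<open>T\<close>, so that their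
      difference is again a Wiener integral.\<close>
    have wl: "wiener_limit M W T (triangle_kernel T K r) (Z r)" if "r \<in> {0..T}" for r
      using wiener_limit_mono[OF volterra_wiener_limit[OF that]] that by simp
    have "(h powr \<delta>) ^ m \<le> T powr (\<delta> * real m - 3) * h ^ 3"
    proof (cases "h = 0")
      case False
      then have "(h powr \<delta>) ^ m = h powr ((\<delta> * real m - 3) + 3)"
        by (simp add: powr_power mult.commute)
      also have "\<dots> = h powr (\<delta> * real m - 3) * h powr 3"
        by (rule powr_add)
      also have "\<dots> = h powr (\<delta> * real m - 3) * h ^ 3"
        using False h by simp
      also have "\<dots> \<le> T powr (\<delta> * real m - 3) * h ^ 3"
        using h m by (intro mult_right_mono powr_mono2) auto
      finally show ?thesis .
    qed (use m in \<open>simp add: zero_power\<close>)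
    then have power: "gaussian_moment m * (C * h powr \<delta>) ^ m \<le> c * h ^ 3"
      using C gaussian_moment_pos[of m] by (simp add: c_def power_mult_distrib mult.assoc)
    have "(\<integral>\<^sup>+\<omega>. ennreal ((Z t \<omega> - Z s \<omega>) ^ (2 * m)) \<partial>M)
        \<le> ennreal (gaussian_moment m * (LINT \<omega>|M. (Z t \<omega> - Z s \<omega>)\<^sup>2) ^ m)"
      using st T by (intro wiener_limit_moment[OF W wiener_limit_diff[OF W wl wl]]) auto
    also have "\<dots> \<le> ennreal (gaussian_moment m * (C * h powr \<delta>) ^ m)"
      using incr[OF st] h gaussian_moment_pos[of m]
      by (intro ennreal_leI mult_left_mono power_mono) (auto simp: h_def)
    also have "\<dots> \<le> ennreal (c * (t - s) ^ 3)"
      using power by (intro ennreal_leI) (simp add: h_def)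
    finally show "(\<integral>\<^sup>+\<omega>. ennreal ((Z t \<omega> - Z s \<omega>) ^ (2 * m)) \<partial>M) \<le> ennreal (c * (t - s) ^ 3)" .
  qed
qed

section \<open>The kernel of the Langevin solution\<close>

lemma triangle_kernel_section_square_integrable:
  "AE u in lborel. (\<integral>\<^sup>+s. ennreal ((triangle_kernel T K s u)\<^sup>2) \<partial>lborel) \<noteq> \<infinity>"
proof (rule nn_integral_PInf_AE)
  have [measurable]: "(\<lambda>(s, u). triangle_kernel T K s u) \<in> borel_measurable (lborel \<Otimes>\<^sub>M lborel)"
    using V by (intro triangle_kernel_measurable) (simp add: gaussian_volterra_process_def)
  have 1: "(\<lambda>(s, u). ennreal ((triangle_kernel T K s u)\<^sup>2)) \<in> borel_measurable (lborel \<Otimes>\<^sub>M lborel)"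
    by measurable
  show "(\<lambda>u. \<integral>\<^sup>+s. ennreal ((triangle_kernel T K s u)\<^sup>2) \<partial>lborel) \<in> borel_measurable lborel"
    by (rule lborel.borel_measurable_nn_integral) measurable
  \<comment> \<open>Tonelli trades columns for rows, and a row integrates to the second moment of
    \<open>Z s\<close> by the isometry, which is bounded on \<open>{0..T}\<close>.\<close>
  have "(\<integral>\<^sup>+u. (\<integral>\<^sup>+s. ennreal ((triangle_kernel T K s u)\<^sup>2) \<partial>lborel) \<partial>lborel)
      = (\<integral>\<^sup>+s. (\<integral>\<^sup>+u. ennreal ((triangle_kernel T K s u)\<^sup>2) \<partial>lborel) \<partial>lborel)"
    using 1 by (intro lborel_pair.Fubini') simp
  also have "\<dots> \<le> (\<integral>\<^sup>+s. ennreal (C * T powr \<delta>) * indicator {0..T} s \<partial>lborel)"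
  proof (rule nn_integral_mono)
    fix s
    show "(\<integral>\<^sup>+u. ennreal ((triangle_kernel T K s u)\<^sup>2) \<partial>lborel) \<le> ennreal (C * T powr \<delta>) * indicator {0..T} s"
    proof (cases "s \<in> {0..T}")
      case True
      note wl = volterra_wiener_limit[OF True]
      have "0 \<le> s" using True by simp
      have "(\<integral>\<^sup>+u. ennreal ((triangle_kernel T K s u)\<^sup>2) \<partial>lborel) = ennreal (LINT \<omega>|M. (Z s \<omega>)\<^sup>2)"
        using wiener_limit_isometry[OF W wl \<open>0 \<le> s\<close>] wiener_limit_square_integrable(1)[OF W wl \<open>0 \<le> s\<close>]
        by (simp add: nn_integral_eq_integral)
      with volterra_second_moment[OF True] True show ?thesis by (simp add: ennreal_leI)
    next
      case False
      then have "triangle_kernel T K s u = 0" for u by (auto simp: triangle_kernel_def)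
      then show ?thesis by simp
    qed
  qed
  also have "\<dots> < \<infinity>" using T by (simp add: nn_integral_cmult_indicator ennreal_mult_less_top)
  finally show "(\<integral>\<^sup>+u. (\<integral>\<^sup>+s. ennreal ((triangle_kernel T K s u)\<^sup>2) \<partial>lborel) \<partial>lborel) \<noteq> \<infinity>"
    by simp
qed

text \<open>Almost every column is square integrable; on a bounded interval
  \<open>\<bar>x\<bar> \<le> 1 + x\<^sup>2\<close> makes it integrable, and the exponential is
  bounded there by \<open>exp (\<bar>\<alpha>\<bar> * T)\<close>.\<close>

lemma langevin_kernel_integrable:
  assumes t: "t \<in> {0..T}"
  shows "AE u in lborel. u \<in> {0..t} \<longrightarrow> set_integrable lborel {u..t} (\<lambda>s. exp (\<alpha> * (t - s)) * K s u)"
  using triangle_kernel_section_square_integrable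
proof eventually_elim
  case (elim u)
  have k: "(\<lambda>(s, u). triangle_kernel T K s u) \<in> borel_measurable (lborel \<Otimes>\<^sub>M lborel)"
    using V by (intro triangle_kernel_measurable) (simp add: gaussian_volterra_process_def)
  then have [measurable]: "(\<lambda>s. triangle_kernel T K s u) \<in> borel_measurable borel"
    using measurable_Pair1[OF k, of u] by simp
  have sq: "integrable lborel (\<lambda>s. (triangle_kernel T K s u)\<^sup>2)"
    using elim by (intro integrableI_nonneg) (auto simp: less_top)
  show ?case
  proof
    assume u: "u \<in> {0..t}"
    define E where "E = exp (\<bar>\<alpha>\<bar> * T)"
    have eq: "indicator {u..t} s *\<^sub>R (exp (\<alpha> * (t - s)) * K s u)
        = indicator {u..t} s * (exp (\<alpha> * (t - s)) * triangle_kernel T K s u)" for s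
      using u t by (auto simp: indicator_def triangle_kernel_def)
    show "set_integrable lborel {u..t} (\<lambda>s. exp (\<alpha> * (t - s)) * K s u)"
      unfolding set_integrable_def eq
    proof (rule Bochner_Integration.integrable_bound)
      show "integrable lborel (\<lambda>s. E * (indicator {u..t} s + (triangle_kernel T K s u)\<^sup>2))"
        using sq u by (intro integrable_mult_right Bochner_Integration.integrable_add)
          (auto simp: integrable_indicator_iff)
      show "AE s in lborel. norm (indicator {u..t} s * (exp (\<alpha> * (t - s)) * triangle_kernel T K s u))
          \<le> norm (E * (indicator {u..t} s + (triangle_kernel T K s u)\<^sup>2))"
      proof (intro AE_I2)
        fix s
        show "norm (indicator {u..t} s * (exp (\<alpha> * (t - s)) * triangle_kernel T K s u))
          \<le> norm (E * (indicator {u..t} s + (triangle_kernel T K s u)\<^sup>2))"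
        proof (cases "s \<in> {u..t}")
          case True
          have "\<alpha> * (t - s) \<le> \<bar>\<alpha>\<bar> * T"
            using True u t by (intro mult_mono) auto
          then have "exp (\<alpha> * (t - s)) \<le> E" by (simp add: E_def)
          moreover have "\<bar>triangle_kernel T K s u\<bar> \<le> 1 + (triangle_kernel T K s u)\<^sup>2"
            using zero_le_power2[of "\<bar>triangle_kernel T K s u\<bar> - 1"] by (simp add: power2_diff)
          ultimately have "exp (\<alpha> * (t - s)) * \<bar>triangle_kernel T K s u\<bar>
              \<le> E * (1 + (triangle_kernel T K s u)\<^sup>2)"
            by (intro mult_mono) (auto simp: E_def)
          then show ?thesis using True by (simp add: abs_mult E_def)
        qed simp
      qed
    qed measurable
  qed
qed

lemma langevin_kernel_measurable:
  "set_borel_measurable borel {(t, s). 0 \<le> s \<and> s \<le> t \<and> t \<le> T} (\<lambda>(t, s). langevin_kernel \<alpha> K t s)"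
proof -
  let ?S = "{(t, s). 0 \<le> s \<and> s \<le> t \<and> t \<le> T}"
  have [measurable]: "(\<lambda>(s, u). triangle_kernel T K s u) \<in> borel_measurable (lborel \<Otimes>\<^sub>M lborel)"
    using V by (intro triangle_kernel_measurable) (simp add: gaussian_volterra_process_def)
  have S: "?S \<in> sets (lborel \<Otimes>\<^sub>M lborel)"
  proof -
    have "{z \<in> space (lborel \<Otimes>\<^sub>M lborel). 0 \<le> snd z \<and> snd z \<le> fst z \<and> fst z \<le> T} \<in> sets (lborel \<Otimes>\<^sub>M lborel)"
      by measurable
    also have "{z \<in> space (lborel \<Otimes>\<^sub>M lborel). 0 \<le> snd z \<and> snd z \<le> fst z \<and> fst z \<le> T} = ?S"
      by (auto simp: space_pair_measure)
    finally show ?thesis .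
  qed
  \<comment> \<open>The limits of integration depend on \<open>z\<close>; the upper one becomes the
    factor \<open>if s \<le> fst z\<close>, the lower one is built into
    \<open>triangle_kernel\<close>, which leaves a jointly measurable integrand over the whole
    line.\<close>
  define F where "F = (\<lambda>z. indicator ?S z * (\<alpha> * (LINT s|lborel. (if s \<le> fst z then 1 else 0) *
      (exp (\<alpha> * (fst z - s)) * triangle_kernel T K s (snd z))) + triangle_kernel T K (fst z) (snd z)))"
  have "(\<lambda>z. LINT s|lborel. (if s \<le> fst z then 1 else 0) *
      (exp (\<alpha> * (fst z - s)) * triangle_kernel T K s (snd z))) \<in> borel_measurable (lborel \<Otimes>\<^sub>M lborel)"
    by (rule lborel.borel_measurable_lebesgue_integral) measurable
  then have F: "F \<in> borel_measurable (lborel \<Otimes>\<^sub>M lborel)"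
    unfolding F_def using S by measurable
  have "indicator ?S z *\<^sub>R (case z of (t, s) \<Rightarrow> langevin_kernel \<alpha> K t s) = F z" for z
  proof (cases "z \<in> ?S")
    case True
    obtain t u where z: "z = (t, u)" by (cases z)
    have "(LBINT s:{u..t}. exp (\<alpha> * (t - s)) * K s u)
        = (LINT s|lborel. (if s \<le> t then 1 else 0) * (exp (\<alpha> * (t - s)) * triangle_kernel T K s u))"
      unfolding set_lebesgue_integral_def using True
      by (intro Bochner_Integration.integral_cong) (auto simp: z indicator_def triangle_kernel_def)
    moreover have "triangle_kernel T K t u = K t u" using True by (simp add: z triangle_kernel_def)
    ultimately show ?thesis using True by (simp add: z F_def langevin_kernel_def)
  qed (simp add: F_def)
  then have "(\<lambda>z. indicator ?S z *\<^sub>R (case z of (t, s) \<Rightarrow> langevin_kernel \<alpha> K t s)) = F" by (rule ext)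
  with F show ?thesis
    unfolding set_borel_measurable_def by (simp add: borel_prod[symmetric] cong: measurable_cong_sets)
qed

section \<open>The Volterra representation of the solution\<close>

context
  fixes X :: "real \<Rightarrow> 'a \<Rightarrow> real"
  assumes X: "continuous_modification M T Z X"
begin

text \<open>Freezing the process outside \<open>[0,T]\<close> makes it jointly measurable on the whole line.\<close>

definition frozen :: "real \<Rightarrow> 'a \<Rightarrow> real" where
  "frozen s \<omega> = X (max 0 (min T s)) \<omega>"

lemma frozen_eq: "s \<in> {0..T} \<Longrightarrow> frozen s \<omega> = X s \<omega>"
  by (simp add: frozen_def)

lemma frozen_measurable: "frozen s \<in> borel_measurable M"
  using X T by (auto simp: frozen_def[abs_def] continuous_modification_def continuous_process_on_def process_on_def)

lemma frozen_jointly_measurable: "(\<lambda>(s, \<omega>). frozen s \<omega>) \<in> borel_measurable (lborel \<Otimes>\<^sub>M M)"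
proof (rule continuous_process_jointly_measurable[OF frozen_measurable])
  fix \<omega> assume "\<omega> \<in> space M"
  then have "continuous_on {0..T} (\<lambda>s. X s \<omega>)"
    using X by (simp add: continuous_modification_def continuous_process_on_def)
  then show "continuous_on UNIV (\<lambda>s. frozen s \<omega>)"
    unfolding frozen_def
    by (rule continuous_on_compose2) (use T in \<open>auto intro!: continuous_intros\<close>)
qed

lemma frozen_eq_volterra: "s \<in> {0..T} \<Longrightarrow> AE \<omega> in M. frozen s \<omega> = Z s \<omega>"
  using X by (simp add: frozen_eq continuous_modification_def)

lemma frozen_wiener_limit:
  assumes "s \<in> {0..T}"
  shows "wiener_limit M W s (triangle_kernel T K s) (frozen s)"
proof (rule wiener_limit_cong_AE[OF W volterra_wiener_limit[OF assms]])
  show "triangle_kernel T K s \<in> borel_measurable borel"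
    using wiener_limit_measurable(1)[OF volterra_wiener_limit[OF assms]] .
  show "AE \<omega> in M. Z s \<omega> = frozen s \<omega>"
    using frozen_eq_volterra[OF assms] by eventually_elim simp
qed (auto intro: frozen_measurable)

text \<open>Stochastic Fubini with the weight \<open>exp (\<alpha> * (t - s))\<close>. Mean-square
  continuity is inherited from \<open>Z\<close>, with which \<open>frozen\<close> agrees almost
  surely at each time of \<open>{0..T}\<close>.\<close>

lemma duhamel_wiener_limit:
  assumes t: "t \<in> {0..T}"
  shows "wiener_limit M W t (\<lambda>u. LINT s|lborel. indicator {0<..t} s * (exp (\<alpha> * (t - s)) * triangle_kernel T K s u))
    (\<lambda>\<omega>. LINT s|lborel. indicator {0<..t} s * (exp (\<alpha> * (t - s)) * frozen s \<omega>))"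
proof (rule wiener_limit_integral[OF W])
  have [measurable]: "(\<lambda>(s, u). triangle_kernel T K s u) \<in> borel_measurable (lborel \<Otimes>\<^sub>M lborel)"
    using V by (intro triangle_kernel_measurable) (simp add: gaussian_volterra_process_def)
  note [measurable] = frozen_jointly_measurable
  have sub: "s \<in> {0..T}" if "s \<in> {0..t}" for s using that t by simp
  show "0 \<le> t" using t by simp
  show "(\<lambda>(s, u). exp (\<alpha> * (t - s)) * triangle_kernel T K s u) \<in> borel_measurable (lborel \<Otimes>\<^sub>M lborel)"
    by measurable
  show "(\<lambda>(s, \<omega>). exp (\<alpha> * (t - s)) * frozen s \<omega>) \<in> borel_measurable (lborel \<Otimes>\<^sub>M M)"
    by measurable
  show "wiener_limit M W t (\<lambda>u. exp (\<alpha> * (t - s)) * triangle_kernel T K s u) (\<lambda>\<omega>. exp (\<alpha> * (t - s)) * frozen s \<omega>)"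
    if "s \<in> {0..t}" for s
    using that by (intro wiener_limit_scale[OF W] wiener_limit_mono[OF frozen_wiener_limit[OF sub[OF that]]]) simp
  have frozen_square: "integrable M (\<lambda>\<omega>. (frozen s \<omega>)\<^sup>2)" if "s \<in> {0..t}" for s
    using wiener_limit_square_integrable(2)[OF W frozen_wiener_limit[OF sub[OF that]]] that by simp
  have frozen_second: "(LINT \<omega>|M. (frozen s \<omega>)\<^sup>2) \<le> C * T powr \<delta>" if "s \<in> {0..t}" for s
  proof -
    have "(LINT \<omega>|M. (frozen s \<omega>)\<^sup>2) = (LINT \<omega>|M. (Z s \<omega>)\<^sup>2)"
      using frozen_eq_volterra[OF sub[OF that]] frozen_measurable[of s] volterra_measurable[OF sub[OF that]]
      by (intro integral_cong_AE) (auto elim!: eventually_mono)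
    then show ?thesis using volterra_second_moment[OF sub[OF that]] by simp
  qed
  have frozen_incr: "(LINT \<omega>|M. (frozen s \<omega> - frozen s' \<omega>)\<^sup>2) \<le> C * \<bar>s - s'\<bar> powr \<delta>"
    if s: "s \<in> {0..t}" and s': "s' \<in> {0..t}" for s s'
  proof -
    note [measurable] = frozen_measurable volterra_measurable[OF sub[OF s]] volterra_measurable[OF sub[OF s']]
    have "AE \<omega> in M. (frozen s \<omega> - frozen s' \<omega>)\<^sup>2 = (Z s \<omega> - Z s' \<omega>)\<^sup>2"
      using frozen_eq_volterra[OF sub[OF s]] frozen_eq_volterra[OF sub[OF s']] by eventually_elim simp
    then have "(LINT \<omega>|M. (frozen s \<omega> - frozen s' \<omega>)\<^sup>2) = (LINT \<omega>|M. (Z s \<omega> - Z s' \<omega>)\<^sup>2)"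
      by (intro integral_cong_AE) measurable
    then show ?thesis using increment_bound[OF sub[OF s] sub[OF s']] by simp
  qed
  show "\<exists>h>0. \<forall>s\<in>{0..t}. \<forall>s'\<in>{0..t}. \<bar>s - s'\<bar> \<le> h \<longrightarrow>
      (\<integral>\<^sup>+\<omega>. ennreal ((exp (\<alpha> * (t - s)) * frozen s \<omega> - exp (\<alpha> * (t - s')) * frozen s' \<omega>)\<^sup>2) \<partial>M) \<le> ennreal e"
    if "0 < e" for e
    by (rule weighted_mean_square_continuous[OF _ C \<delta> frozen_measurable frozen_square frozen_second frozen_incr that])
      (auto intro!: continuous_intros)
qed

lemma duhamel_eq_frozen:
  assumes t: "t \<in> {0..T}"
  shows "exp (\<alpha> * t) * (LBINT s:{0..t}. exp (- \<alpha> * s) * X s \<omega>)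
    = (LINT s|lborel. indicator {0<..t} s * (exp (\<alpha> * (t - s)) * frozen s \<omega>))"
proof -
  have "exp (\<alpha> * t) * (LBINT s:{0..t}. exp (- \<alpha> * s) * X s \<omega>)
      = (LINT s|lborel. exp (\<alpha> * t) * (indicator {0..t} s *\<^sub>R (exp (- \<alpha> * s) * X s \<omega>)))"
    unfolding set_lebesgue_integral_def by (rule integral_mult_right_zero[symmetric])
  also have "\<dots> = (LINT s|lborel. indicator {0..t} s * (exp (\<alpha> * (t - s)) * frozen s \<omega>))"
    using t by (intro Bochner_Integration.integral_cong)
      (auto simp: indicator_def frozen_eq right_diff_distrib exp_diff exp_minus field_simps)
  also have "\<dots> = (LINT s|lborel. indicator {0<..t} s * (exp (\<alpha> * (t - s)) * frozen s \<omega>))"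
    by (rule integral_indicator_half_open)
  finally show ?thesis .
qed

text \<open>The stochastic Fubini identity, scaled by \<alpha>, plus \<open>X t\<close> itself. The
  kernel identity holds for every \<open>u\<close>, also where the inner integral does not exist,
  since both integrals then take the same default value.\<close>

lemma langevin_solution_volterra:
  "gaussian_volterra_process M W T (langevin_kernel \<alpha> K)
    (\<lambda>t \<omega>. \<alpha> * (exp (\<alpha> * t) * (LBINT s:{0..t}. exp (- \<alpha> * s) * X s \<omega>)) + X t \<omega>)"
proof -
  have rep: "has_wiener_integral M W t (langevin_kernel \<alpha> K t)
      (\<lambda>\<omega>. \<alpha> * (exp (\<alpha> * t) * (LBINT s:{0..t}. exp (- \<alpha> * s) * X s \<omega>)) + X t \<omega>)"
    if t: "t \<in> {0..T}" for t
  proof -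
    have kernel: "indicator {0..t} u * langevin_kernel \<alpha> K t u
        = \<alpha> * (LINT s|lborel. indicator {0<..t} s * (exp (\<alpha> * (t - s)) * triangle_kernel T K s u))
          + triangle_kernel T K t u" for u
    proof (cases "u \<in> {0..t}")
      case True
      have "(LBINT s:{u..t}. exp (\<alpha> * (t - s)) * K s u)
          = (LINT s|lborel. indicator {0..t} s * (exp (\<alpha> * (t - s)) * triangle_kernel T K s u))"
        unfolding set_lebesgue_integral_def using True t
        by (intro Bochner_Integration.integral_cong) (auto simp: indicator_def triangle_kernel_def)
      also have "\<dots> = (LINT s|lborel. indicator {0<..t} s * (exp (\<alpha> * (t - s)) * triangle_kernel T K s u))"
        by (rule integral_indicator_half_open)
      finally show ?thesis using True t by (simp add: langevin_kernel_def triangle_kernel_def)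
    next
      case False
      then have zero: "indicator {0<..t} s * (exp (\<alpha> * (t - s)) * triangle_kernel T K s u) = 0" for s
        by (auto simp: indicator_def triangle_kernel_def)
      have "triangle_kernel T K t u = 0" using False by (auto simp: triangle_kernel_def)
      then show ?thesis using False unfolding zero by simp
    qed
    have "wiener_limit M W t
        (\<lambda>u. \<alpha> * (LINT s|lborel. indicator {0<..t} s * (exp (\<alpha> * (t - s)) * triangle_kernel T K s u))
          + triangle_kernel T K t u)
        (\<lambda>\<omega>. \<alpha> * (LINT s|lborel. indicator {0<..t} s * (exp (\<alpha> * (t - s)) * frozen s \<omega>)) + frozen t \<omega>)"
      by (intro wiener_limit_add[OF W] wiener_limit_scale[OF W] duhamel_wiener_limit frozen_wiener_limit t)
    then show ?thesis
      using t by (simp only: has_wiener_integral_iff_wiener_limit[OF W] atLeastAtMost_iff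
          kernel duhamel_eq_frozen frozen_eq)
  qed
  \<comment> \<open>The square integrability asked for by \<open>volterra_kernel\<close> is already
    part of \<open>has_wiener_integral\<close>.\<close>
  then show ?thesis
    using langevin_kernel_measurable
    by (simp add: gaussian_volterra_process_def volterra_kernel_def has_wiener_integral_def)
qed

lemma duhamel_measurable:
  assumes t: "t \<in> {0..T}"
  shows "(\<lambda>\<omega>. exp (\<alpha> * t) * (LBINT s:{0..t}. exp (- \<alpha> * s) * X s \<omega>)) \<in> borel_measurable M"
  unfolding duhamel_eq_frozen[OF t]
  by (rule wiener_limit_measurable(2)[OF duhamel_wiener_limit[OF t]])

end

end

theorem proposition14:
  fixes M :: "'a measure"
    and W Z :: "real \<Rightarrow> 'a \<Rightarrow> real"
    and K :: "real \<Rightarrow> real \<Rightarrow> real"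
    and \<alpha> T C \<delta> :: real
  assumes "wiener_process M W"
    and "T > 0"
    and "gaussian_volterra_process M W T K Z"
    and "C > 0" and "\<delta> > 0"
    and "\<And>s t. 0 \<le> s \<Longrightarrow> s \<le> t \<Longrightarrow> t \<le> T \<Longrightarrow>
           (LINT \<omega>|M. (Z t \<omega> - Z s \<omega>)\<^sup>2) \<le> C * \<bar>t - s\<bar> powr \<delta>"
  shows "(\<exists>X. continuous_modification M T Z X) \<and>
    (\<forall>X. continuous_modification M T Z X \<longrightarrow>
      (let U = (\<lambda>t \<omega>. exp (\<alpha> * t) * (LBINT s:{0..t}. exp (- \<alpha> * s) * X s \<omega>));
           Y = (\<lambda>t \<omega>. \<alpha> * exp (\<alpha> * t) * (LBINT s:{0..t}. exp (- \<alpha> * s) * X s \<omega>) + X t \<omega>)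
       in
         (continuous_process_on M T U \<and> solves_linear_ode M T \<alpha> X U \<and>
          (\<forall>V. solves_linear_ode M T \<alpha> X V \<longrightarrow> indistinguishable_on M T V U)) \<and>
         (continuous_process_on M T Y \<and> solves_langevin M T \<alpha> X Y \<and>
          (\<forall>V. solves_langevin M T \<alpha> X V \<longrightarrow> indistinguishable_on M T V Y)) \<and>
         (\<forall>\<omega>\<in>space M. \<forall>t\<in>{0..T}.
            ((\<lambda>r. U r \<omega>) has_real_derivative Y t \<omega>) (at t within {0..T})) \<and>
         (\<forall>t\<in>{0..T}. AE u in lborel. u \<in> {0..t} \<longrightarrow>
            set_integrable lborel {u..t} (\<lambda>s. exp (\<alpha> * (t - s)) * K s u)) \<and>
         gaussian_volterra_process M W T (langevin_kernel \<alpha> K) Y))"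
proof (intro conjI allI impI)
  note setting = assms
  show "\<exists>X. continuous_modification M T Z X"
    using setting by (rule continuous_modification_exists)
  fix X assume X: "continuous_modification M T Z X"
  define U where "U t \<omega> = exp (\<alpha> * t) * (LBINT s:{0..t}. exp (- \<alpha> * s) * X s \<omega>)" for t \<omega>
  define Y where "Y t \<omega> = \<alpha> * exp (\<alpha> * t) * (LBINT s:{0..t}. exp (- \<alpha> * s) * X s \<omega>) + X t \<omega>" for t \<omega>
  have Y_eq: "Y t \<omega> = \<alpha> * U t \<omega> + X t \<omega>" for t \<omega>
    by (simp add: Y_def U_def)
  have X_meas: "X t \<in> borel_measurable M" if "t \<in> {0..T}" for t
    using X that by (simp add: continuous_modification_def continuous_process_on_def process_on_def)
  have X_cont: "continuous_on {0..T} (\<lambda>t. X t \<omega>)" if "\<omega> \<in> space M" for \<omega>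
    using X that by (simp add: continuous_modification_def continuous_process_on_def)
  have U_meas: "U t \<in> borel_measurable M" if "t \<in> {0..T}" for t
    unfolding U_def[abs_def] using setting X that by (rule duhamel_measurable)
  have Y_meas: "Y t \<in> borel_measurable M" if "t \<in> {0..T}" for t
    unfolding Y_eq[abs_def] using U_meas[OF that] X_meas[OF that] by measurable
  have deriv: "((\<lambda>r. U r \<omega>) has_real_derivative Y t \<omega>) (at t within {0..T})"
    if "\<omega> \<in> space M" "t \<in> {0..T}" for \<omega> t
    unfolding Y_eq U_def by (rule duhamel_has_derivative[OF X_cont[OF that(1)] \<open>T > 0\<close> that(2)])
  have U0: "U 0 \<omega> = 0" if "\<omega> \<in> space M" for \<omega>
    unfolding U_def by (rule duhamel_zero[OF X_cont[OF that] \<open>T > 0\<close>])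
  have Y_cont: "continuous_on {0..T} (\<lambda>t. Y t \<omega>)" if "\<omega> \<in> space M" for \<omega>
    unfolding Y_eq U_def by (rule langevin_solution_continuous[OF X_cont[OF that] \<open>T > 0\<close>])
  have U_process: "continuous_process_on M T U"
    unfolding continuous_process_on_def process_on_def
    using U_meas DERIV_continuous_on[OF deriv] by blast
  have Y_process: "continuous_process_on M T Y"
    unfolding continuous_process_on_def process_on_def
    using Y_meas Y_cont by blast
  have U_solves: "solves_linear_ode M T \<alpha> X U"
    unfolding solves_linear_ode_def process_on_def
  proof (intro conjI ballI AE_I2)
    fix \<omega> t assume "\<omega> \<in> space M" "t \<in> {0..T}"
    then show "\<exists>D. ((\<lambda>r. U r \<omega>) has_real_derivative D) (at t within {0..T}) \<and> D - \<alpha> * U t \<omega> = X t \<omega>"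
      using deriv by (intro exI[of _ "Y t \<omega>"]) (simp add: Y_eq)
  qed (use U_meas U0 in auto)
  have U_unique: "indistinguishable_on M T S U" if S: "solves_linear_ode M T \<alpha> X S" for S
  proof -
    have "AE \<omega> in M. S 0 \<omega> = 0 \<and> (\<forall>t\<in>{0..T}. \<exists>D. ((\<lambda>r. S r \<omega>) has_real_derivative D) (at t within {0..T}) \<and>
        D - \<alpha> * S t \<omega> = X t \<omega>)"
      using S by (simp add: solves_linear_ode_def)
    \<comment> \<open>The pathwise lemmas need a continuous path of \<open>X\<close>, which is given
      on \<open>space M\<close>; \<open>AE_space\<close> adds this to the almost sure
      equation.\<close>
    then show ?thesis
      unfolding indistinguishable_on_def using AE_space
    proof eventually_elim
      case (elim \<omega>)
      have "((\<lambda>r. S r \<omega>) has_real_derivative \<alpha> * S t \<omega> + X t \<omega>) (at t within {0..T})" if "t \<in> {0..T}" for t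
      proof -
        from bspec[OF conjunct2[OF elim(1)] that] obtain D where
          "((\<lambda>r. S r \<omega>) has_real_derivative D) (at t within {0..T})" "D - \<alpha> * S t \<omega> = X t \<omega>"
          by (elim exE conjE)
        moreover from this(2) have "D = \<alpha> * S t \<omega> + X t \<omega>" by simp
        ultimately show ?thesis by simp
      qed
      then show ?case
        unfolding U_def using elim by (intro ballI duhamel_unique[OF X_cont \<open>T > 0\<close>]) auto
    qed
  qed
  have Y_solves: "solves_langevin M T \<alpha> X Y"
    unfolding solves_langevin_def process_on_def
  proof (intro conjI ballI AE_I2)
    fix \<omega> assume \<omega>: "\<omega> \<in> space M"
    have "set_integrable lborel {0..T} (\<lambda>s. Y s \<omega>)"
      using Y_process \<omega> by (intro borel_integrable_atLeastAtMost') (simp add: continuous_process_on_def)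
    then show "set_integrable lebesgue {0..T} (\<lambda>s. Y s \<omega>)"
      by (simp add: set_integrable_def integrable_completion)
    fix t assume t: "t \<in> {0..T}"
    have "(LINT s:{0..t}|lebesgue. Y s \<omega>) = U t \<omega>"
      unfolding Y_eq U_def
      by (rule set_lebesgue_integral_langevin_solution[OF X_cont[OF \<omega>] \<open>T > 0\<close> t])
    then show "Y t \<omega> = \<alpha> * (LINT s:{0..t}|lebesgue. Y s \<omega>) + X t \<omega>"
      by (simp add: Y_eq)
  qed (use Y_meas in auto)
  have Y_unique: "indistinguishable_on M T S Y" if S: "solves_langevin M T \<alpha> X S" for S
  proof -
    have "AE \<omega> in M. set_integrable lebesgue {0..T} (\<lambda>s. S s \<omega>) \<and>
        (\<forall>t\<in>{0..T}. S t \<omega> = \<alpha> * (LINT s:{0..t}|lebesgue. S s \<omega>) + X t \<omega>)"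
      using S by (simp add: solves_langevin_def)
    then show ?thesis
      unfolding indistinguishable_on_def using AE_space
    proof eventually_elim
      case (elim \<omega>)
      then show ?case
        unfolding Y_eq U_def by (intro ballI langevin_unique[OF X_cont \<open>T > 0\<close>]) blast+
    qed
  qed
  have kernel: "\<forall>t\<in>{0..T}. AE u in lborel. u \<in> {0..t} \<longrightarrow>
      set_integrable lborel {u..t} (\<lambda>s. exp (\<alpha> * (t - s)) * K s u)"
    using langevin_kernel_integrable[OF setting] by blast
  have volterra: "gaussian_volterra_process M W T (langevin_kernel \<alpha> K) Y"
    using langevin_solution_volterra[OF setting X, of \<alpha>] by (simp add: Y_eq[abs_def] U_def)
  show "let U = (\<lambda>t \<omega>. exp (\<alpha> * t) * (LBINT s:{0..t}. exp (- \<alpha> * s) * X s \<omega>));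
           Y = (\<lambda>t \<omega>. \<alpha> * exp (\<alpha> * t) * (LBINT s:{0..t}. exp (- \<alpha> * s) * X s \<omega>) + X t \<omega>)
       in
         (continuous_process_on M T U \<and> solves_linear_ode M T \<alpha> X U \<and>
          (\<forall>V. solves_linear_ode M T \<alpha> X V \<longrightarrow> indistinguishable_on M T V U)) \<and>
         (continuous_process_on M T Y \<and> solves_langevin M T \<alpha> X Y \<and>
          (\<forall>V. solves_langevin M T \<alpha> X V \<longrightarrow> indistinguishable_on M T V Y)) \<and>
         (\<forall>\<omega>\<in>space M. \<forall>t\<in>{0..T}.
            ((\<lambda>r. U r \<omega>) has_real_derivative Y t \<omega>) (at t within {0..T})) \<and>
         (\<forall>t\<in>{0..T}. AE u in lborel. u \<in> {0..t} \<longrightarrow>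
            set_integrable lborel {u..t} (\<lambda>s. exp (\<alpha> * (t - s)) * K s u)) \<and>
         gaussian_volterra_process M W T (langevin_kernel \<alpha> K) Y"
    unfolding Let_def U_def[abs_def, symmetric] Y_def[abs_def, symmetric]
    using U_process U_solves U_unique Y_process Y_solves Y_unique deriv kernel volterra by blast
qed

end
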